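(* In the setting of the context, let $\nabla=\nabla_{I_0}(I)$. The map \[ T_{I_0}(I)\to\operatorname{Strata}_\Delta(I_0),\qquad F\mapsto \sum_{i=1}^c\left(F^*\cap\Delta_i\right) \] (Minkowski sum), obtained by composing $F\mapsto F^*$ with $F^*\mapsto\sum_i(F^*\cap\Delta_i)$, is well defined and is an inclusion-reversing bijection. In particular, $T_{I_0}(I)$ is combinatorially dual to the complex $\operatorname{Strata}_\Delta(I_0)$.
   Context: Setting: let $N\cong\mathbb{Z}^n$, $M=\operatorname{Hom}(N,\mathbb{Z})$, with pairing $\langle\cdot,\cdot\rangle$. Let $\Delta\subset M_\mathbb{R}$ be a reflexive polytope, $\Sigma$ its normal fan, and $Y=\mathbb{P}(\Delta)$. Write $\Sigma(1)$ for the rays, $\hat r$ for primitive generators, and $D_r$ for the corresponding divisors. The Cox ring is $S=\mathbb{C}[x_r\mid r\in\Sigma(1)]$ with $A_{n-1}(Y)$-grading, and $A(u)=(\langle u,\hat r\rangle)_r$ for $u\in M$. Let $\Sigma(1)=J_1\cup\dots\cup J_c$ be a nef partition, i.e. each $E_j=\sum_{r\in J_j}D_r$ is Cartier and globally generated. Let $\Delta_j=\{u:\langle u,\hat r\rangle\ge-1\ (r\in J_j),\ \ge0\ (r\notin J_j)\}$. Set $m_j=\prod_{r\in J_j}x_r$ and $I_0=\langle m_1,\dots,m_c\rangle$. Let $g_j\in S_{[E_j]}$ be a general combination, with generic nonzero coefficients, of all monomials of degree $[E_j]$ not in $I_0$, and $I=\langle tg_j+m_j\rangle\subset\mathbb{C}[t]\otimes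 S$. For $w_x\in N_\mathbb{R}$, $\varphi(w_x)\in\mathbb{R}^{\Sigma(1)}$ denotes any vector with $\sum_r\varphi(w_x)_r\hat r=w_x$. Fix a monomial order $>$ respecting the Cox grading and local in $t$. $>_\omega$ orders monomials by $\omega$-weight (larger first), with ties broken by $>$. $C_{I_0}(I)$ is the closure of $\{-(w_t,w_x): L_{>_{(w_t,\varphi(w_x))}}(I)=I_0\cdot(\mathbb{C}[t]\otimes S)\}$, and $\nabla_{I_0}(I)=\{w\in N_\mathbb{R}:(1,w)\in C_{I_0}(I)\}$, a polytope. For $P\subset N_\mathbb{R}$ with $0\in P$, $P^*=\{u\in M_\mathbb{R}:\langle u,w\rangle\ge-1\ \forall w\in P\}$. For a face $F$ of $\nabla_{I_0}(I)$, the dual face is $F^*=\{u\in\nabla_{I_0}(I)^*:\langle u,w\rangle=-1\ \forall w\in F\}$. Bergman fan: $\operatorname{BF}(I)$ is the set of $(w_t,w_x)\in\mathbb{R}\oplus N_\mathbb{R}$ such that the initial ideal of $I$ with respect to the weight $(w_t,\varphi(w_x))$ contains no monomial. Here the initial form of a polynomial is the sum of its terms of minimal weight, $t$ has weight $w_t$, and the initial ideal is generated by the initial forms of all elements of $I$. (This is the tropical variety of $I$ with $t$ treated as a variable.) Special fiber tropical variety: $T_{I_0}(I)$ is the set of nonempty faces $F$ of $\nabla_{I_0}(I)$ lying in its boundary such that $\{1\}\times F\subset\operatorname{BF}(I)$. It is a subcomplex of $\partial\nabla_{I_0}(I)$. Strata complex: for a nonempty face $G$ of $\Delta$, let $R(G)=\{r\in\Sigma(1):\langle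 u,\hat r\rangle=-1\ \forall u\in G\}$. The torus-invariant stratum of $Y$ corresponding to $G$ has ideal $\langle x_r: r\in R(G)\rangle$. Then $\operatorname{Strata}_\Delta(I_0)$ is the set of nonempty faces $G$ of $\Delta$ with $I_0\subset\langle x_r:r\in R(G)\rangle$, i.e. with $R(G)\cap J_j\neq\emptyset$ for all $j$. These are the faces of $\Delta$ whose strata lie in $V(I_0)$. *)

theory Defs
  imports "HOL-Analysis.Analysis" "HOL-Library.Poly_Mapping" "HOL-Library.Set_Algebras"
begin

section \<open>Lattice and polytope notions (N_R = M_R = real^'n, pairing = inner product)\<close>

definition integral_vec :: "real^'n \<Rightarrow> bool" where
  "integral_vec x \<longleftrightarrow> (\<forall>i. x $ i \<in> \<int>)"

definition primitive_vec :: "real^'n \<Rightarrow> bool" where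
  "primitive_vec r \<longleftrightarrow> integral_vec r \<and> r \<noteq> 0 \<and>
     (\<forall>(s::real^'n) (k::real). integral_vec s \<and> k > 0 \<and> r = k *\<^sub>R s \<longrightarrow> k \<le> 1)"

definition lattice_polytope :: "(real^'n) set \<Rightarrow> bool" where
  "lattice_polytope P \<longleftrightarrow> (\<exists>V. finite V \<and> (\<forall>v\<in>V. integral_vec v) \<and> P = convex hull V)"

definition reflexive :: "(real^'n) set \<Rightarrow> bool" where
  "reflexive P \<longleftrightarrow> lattice_polytope P \<and> 0 \<in> interior P \<and>
     (\<forall>F. F facet_of P \<longrightarrow> (\<exists>r. integral_vec r \<and> (\<forall>u\<in>P. inner u r \<ge> -1) \<and> (\<forall>u\<in>F. inner u r = -1)))"

text \<open>Primitive generators of the rays of the (inner) normal fan of P: primitive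
  inward normals of the facets of P.\<close>
definition ray_generators :: "(real^'n) set \<Rightarrow> (real^'n) set" where
  "ray_generators P = {r. primitive_vec r \<and>
     (\<exists>F. F facet_of P \<and> (\<forall>u\<in>P. \<forall>v\<in>F. inner v r \<le> inner u r))}"

definition polar :: "(real^'n) set \<Rightarrow> (real^'n) set" where
  "polar P = {u. \<forall>w\<in>P. inner u w \<ge> -1}"

definition dual_face :: "(real^'n) set \<Rightarrow> (real^'n) set \<Rightarrow> (real^'n) set" where
  "dual_face P F = {u \<in> polar P. \<forall>w\<in>F. inner u w = -1}"

fun minkowski_sum :: "(nat \<Rightarrow> (real^'n) set) \<Rightarrow> nat \<Rightarrow> (real^'n) set" where
  "minkowski_sum A 0 = {0}"
| "minkowski_sum A (Suc k) = minkowski_sum A k + A k"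

section \<open>Nef partitions; rays are indexed by a finite type 'r via rhat\<close>

definition Jind :: "(nat \<Rightarrow> 'r set) \<Rightarrow> nat \<Rightarrow> 'r \<Rightarrow> real" where
  "Jind J j r = (if r \<in> J j then 1 else 0)"

text \<open>Parts J 0, ..., J (c-1).  E_j = sum_{r in J j} D_r is Cartier and globally
  generated: maximal cones of the normal fan correspond to vertices v of P, with rays
  {r. <v, rhat r> = -1}; Cartier data m_v integral with <m_v, rhat r> = -a_r on those rays,
  and global generation means m_v lies in P_{E_j} = {u. <u, rhat r> >= -a_r for all r}.\<close>
definition nef_partition :: "(real^'n) set \<Rightarrow> ('r \<Rightarrow> real^'n) \<Rightarrow> nat \<Rightarrow> (nat \<Rightarrow> 'r set) \<Rightarrow> bool" where
  "nef_partition P rhat c J \<longleftrightarrow>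
     (\<forall>j<c. J j \<noteq> {}) \<and> (\<forall>i<c. \<forall>j<c. i \<noteq> j \<longrightarrow> J i \<inter> J j = {}) \<and>
     (\<Union>j<c. J j) = UNIV \<and>
     (\<forall>j<c. \<forall>v. v extreme_point_of P \<longrightarrow>
        (\<exists>m. integral_vec m \<and>
             (\<forall>r. inner v (rhat r) = -1 \<longrightarrow> inner m (rhat r) = - Jind J j r) \<and>
             (\<forall>r. inner m (rhat r) \<ge> - Jind J j r)))"

definition Delta_part :: "('r \<Rightarrow> real^'n) \<Rightarrow> (nat \<Rightarrow> 'r set) \<Rightarrow> nat \<Rightarrow> (real^'n) set" where
  "Delta_part rhat J j = {u. \<forall>r. inner u (rhat r) \<ge> - Jind J j r}"

section \<open>Multivariate polynomials: C[t] (x) S with variables 'r option (None = t)\<close>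

type_synonym 'v mono = "'v \<Rightarrow>\<^sub>0 nat"
type_synonym 'v mpoly = "'v mono \<Rightarrow>\<^sub>0 complex"

definition monomial :: "'v mono \<Rightarrow> 'v mpoly" where
  "monomial a = Poly_Mapping.single a 1"

definition var :: "'v \<Rightarrow> 'v mpoly" where
  "var v = monomial (Poly_Mapping.single v 1)"

definition ideal_gen :: "'v mpoly set \<Rightarrow> 'v mpoly set" where
  "ideal_gen G = {p. \<exists>S h. finite S \<and> S \<subseteq> G \<and> p = (\<Sum>g\<in>S. h g * g)}"

definition poly_eval :: "'v mpoly \<Rightarrow> ('v \<Rightarrow> complex) \<Rightarrow> complex" where
  "poly_eval p x = (\<Sum>a\<in>Poly_Mapping.keys p. Poly_Mapping.lookup p a * (\<Prod>v\<in>Poly_Mapping.keys (a::'v mono). x v ^ Poly_Mapping.lookup a v))"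

definition mweight :: "('v \<Rightarrow> real) \<Rightarrow> 'v mono \<Rightarrow> real" where
  "mweight \<omega> a = (\<Sum>v\<in>Poly_Mapping.keys a. of_nat (Poly_Mapping.lookup a v) * \<omega> v)"

definition init_form :: "('v \<Rightarrow> real) \<Rightarrow> 'v mpoly \<Rightarrow> 'v mpoly" where
  "init_form \<omega> p = (\<Sum>a\<in>{a\<in>Poly_Mapping.keys p. mweight \<omega> a = Min (mweight \<omega> ` Poly_Mapping.keys p)}.
                      Poly_Mapping.single a (Poly_Mapping.lookup p a))"

definition init_ideal :: "('v \<Rightarrow> real) \<Rightarrow> 'v mpoly set \<Rightarrow> 'v mpoly set" where
  "init_ideal \<omega> I = ideal_gen (init_form \<omega> ` I)"

definition monomial_order :: "('v mono \<Rightarrow> 'v mono \<Rightarrow> bool) \<Rightarrow> bool" where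
  "monomial_order gt \<longleftrightarrow> (\<forall>a. \<not> gt a a) \<and> (\<forall>a b c. gt a b \<longrightarrow> gt b c \<longrightarrow> gt a c) \<and>
     (\<forall>a b. a \<noteq> b \<longrightarrow> gt a b \<or> gt b a) \<and> (\<forall>a b c. gt a b \<longrightarrow> gt (a + c) (b + c))"

text \<open>Order on C[t] (x) S respecting the Cox grading (global in the x-variables) and
  local in t.\<close>
definition admissible_order :: "('r option mono \<Rightarrow> 'r option mono \<Rightarrow> bool) \<Rightarrow> bool" where
  "admissible_order gt \<longleftrightarrow> monomial_order gt \<and> gt 0 (Poly_Mapping.single None 1) \<and>
     (\<forall>r. gt (Poly_Mapping.single (Some r) 1) 0)"

definition weight_order :: "('v \<Rightarrow> real) \<Rightarrow> ('v mono \<Rightarrow> 'v mono \<Rightarrow> bool) \<Rightarrow> 'v mono \<Rightarrow> 'v mono \<Rightarrow> bool" where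
  "weight_order \<omega> gt a b \<longleftrightarrow> mweight \<omega> a > mweight \<omega> b \<or> (mweight \<omega> a = mweight \<omega> b \<and> gt a b)"

definition lead_mono :: "('v mono \<Rightarrow> 'v mono \<Rightarrow> bool) \<Rightarrow> 'v mpoly \<Rightarrow> 'v mono" where
  "lead_mono gt p = (THE a. a \<in> Poly_Mapping.keys p \<and> (\<forall>b\<in>Poly_Mapping.keys p. b \<noteq> a \<longrightarrow> gt a b))"

definition lead_ideal :: "('v mono \<Rightarrow> 'v mono \<Rightarrow> bool) \<Rightarrow> 'v mpoly set \<Rightarrow> 'v mpoly set" where
  "lead_ideal gt I = ideal_gen {monomial (lead_mono gt p) | p. p \<in> I \<and> p \<noteq> 0}"

definition tw :: "real \<Rightarrow> ('r \<Rightarrow> real) \<Rightarrow> 'r option \<Rightarrow> real" where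
  "tw wt \<phi> v = (case v of None \<Rightarrow> wt | Some r \<Rightarrow> \<phi> r)"

definition m_gen :: "(nat \<Rightarrow> 'r set) \<Rightarrow> nat \<Rightarrow> 'r option mpoly" where
  "m_gen J j = monomial (\<Sum>r\<in>J j. Poly_Mapping.single (Some r) 1)"

definition in_I0 :: "nat \<Rightarrow> (nat \<Rightarrow> 'r set) \<Rightarrow> 'r option mono \<Rightarrow> bool" where
  "in_I0 c J a \<longleftrightarrow> (\<exists>k<c. \<forall>r\<in>J k. Poly_Mapping.lookup a (Some r) \<ge> 1)"

text \<open>Monomials of S (no t) of Cox degree [E_j], i.e. exponent vector minus the
  indicator of J j lies in A(M), that are not in I_0.\<close>
definition g_monos :: "('r \<Rightarrow> real^'n) \<Rightarrow> nat \<Rightarrow> (nat \<Rightarrow> 'r set) \<Rightarrow> nat \<Rightarrow> 'r option mono set" where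
  "g_monos rhat c J j = {a. None \<notin> Poly_Mapping.keys a \<and>
      (\<exists>u. integral_vec u \<and> (\<forall>r. of_nat (Poly_Mapping.lookup a (Some r)) - Jind J j r = inner u (rhat r))) \<and>
      \<not> in_I0 c J a}"

definition g_poly :: "('r \<Rightarrow> real^'n) \<Rightarrow> nat \<Rightarrow> (nat \<Rightarrow> 'r set) \<Rightarrow> (nat \<times> 'r option mono \<Rightarrow> complex) \<Rightarrow> nat \<Rightarrow> 'r option mpoly" where
  "g_poly rhat c J coef j = (\<Sum>a\<in>g_monos rhat c J j. Poly_Mapping.single a (coef (j, a)))"

definition I0_ext :: "nat \<Rightarrow> (nat \<Rightarrow> 'r set) \<Rightarrow> 'r option mpoly set" where
  "I0_ext c J = ideal_gen {m_gen J j | j. j < c}"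

definition I_fam :: "('r \<Rightarrow> real^'n) \<Rightarrow> nat \<Rightarrow> (nat \<Rightarrow> 'r set) \<Rightarrow> (nat \<times> 'r option mono \<Rightarrow> complex) \<Rightarrow> 'r option mpoly set" where
  "I_fam rhat c J coef = ideal_gen {var None * g_poly rhat c J coef j + m_gen J j | j. j < c}"

definition phi_of :: "('r::finite \<Rightarrow> real^'n) \<Rightarrow> ('r \<Rightarrow> real) \<Rightarrow> real^'n \<Rightarrow> bool" where
  "phi_of rhat \<phi> wx \<longleftrightarrow> (\<Sum>r\<in>UNIV. \<phi> r *\<^sub>R rhat r) = wx"

definition cone_C :: "('r::finite option mono \<Rightarrow> 'r option mono \<Rightarrow> bool) \<Rightarrow> ('r \<Rightarrow> real^'n) \<Rightarrow> 'r option mpoly set \<Rightarrow> 'r option mpoly set \<Rightarrow> (real \<times> (real^'n)) set" where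
  "cone_C gt rhat I0 I = closure {(-wt, -wx) | wt wx. \<exists>\<phi>. phi_of rhat \<phi> wx \<and>
       lead_ideal (weight_order (tw wt \<phi>) gt) I = I0}"

definition nabla :: "('r::finite option mono \<Rightarrow> 'r option mono \<Rightarrow> bool) \<Rightarrow> ('r \<Rightarrow> real^'n) \<Rightarrow> 'r option mpoly set \<Rightarrow> 'r option mpoly set \<Rightarrow> (real^'n) set" where
  "nabla gt rhat I0 I = {w. (1, w) \<in> cone_C gt rhat I0 I}"

definition bergman_fan :: "('r::finite \<Rightarrow> real^'n) \<Rightarrow> 'r option mpoly set \<Rightarrow> (real \<times> (real^'n)) set" where
  "bergman_fan rhat I = {(wt, wx) | wt wx. \<exists>\<phi>. phi_of rhat \<phi> wx \<and>
       (\<forall>a. monomial a \<notin> init_ideal (tw wt \<phi>) I)}"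

definition trop_special :: "(real^'n) set \<Rightarrow> (real \<times> (real^'n)) set \<Rightarrow> (real^'n) set set" where
  "trop_special Nab BF = {F. F face_of Nab \<and> F \<noteq> {} \<and> F \<subseteq> frontier Nab \<and> (\<forall>w\<in>F. (1, w) \<in> BF)}"

definition strata :: "(real^'n) set \<Rightarrow> ('r \<Rightarrow> real^'n) \<Rightarrow> nat \<Rightarrow> (nat \<Rightarrow> 'r set) \<Rightarrow> (real^'n) set set" where
  "strata P rhat c J = {G. G face_of P \<and> G \<noteq> {} \<and>
      (\<forall>j<c. \<exists>r\<in>J j. \<forall>u\<in>G. inner u (rhat r) = -1)}"

end

theory Submission
  imports Defs
begin

text \<open>The idea. The monomials \<open>m_j\<close> are pairwise coprime, so whenever the weight makes them the
  leading terms, the generators \<open>t g_j + m_j\<close> form a standard basis. Hence \<open>\<nabla>\<close> is the polyhedron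
  \<open>\<langle>u,w\<rangle> \<ge> -1\<close> for the lattice points \<open>u\<close> coming from the monomials of all \<open>g_j\<close>, and a point
  \<open>(1,w)\<close> with \<open>w \<in> \<nabla>\<close> lies in the Bergman fan iff for every \<open>j\<close> some monomial of \<open>g_j\<close> is tight
  at \<open>w\<close>. This says exactly that \<open>w\<close> has minimum \<open>-1\<close> on every \<open>\<Delta>_j\<close>, so by the nef condition
  the minimal faces of the \<open>\<Delta>_j\<close> add up to the face of \<open>\<Delta>\<close> on which \<open>w\<close> takes its minimum \<open>-c\<close>;
  that face is the image of the face of \<open>\<nabla>\<close> containing \<open>w\<close> in its relative interior. In the other
  direction, a face \<open>G\<close> with \<open>R(G) \<inter> J_j \<noteq> \<emptyset>\<close> is recovered from the sum over \<open>j\<close> of the averages of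
  the rays in \<open>R(G) \<inter> J_j\<close>.\<close>

text \<open>Removing the monomials of I_0 leaves \<open>Xi j\<close>, a proper part of the lattice
  points of \<open>D j\<close>, so a point of \<nabla> is not a priori bounded below by
  \<open>-1\<close> on \<open>D j\<close>. Where every part reaches \<open>-1\<close>
  simultaneously, the missing inequalities do follow; hence the set \<open>tight\<close>, free of
  polynomials, on which the whole face duality runs. Each face is handled through one relative
  interior point. An order local in t and global in the x_r is not a well-order, so reduction cannot
  rest on well-foundedness. The cone and the fan only ask for some \<phi> over the given vector; it
  may be taken of one sign, the same as the weight of t, and then the finiteness of the set of
  larger monomials takes over. Genericity has to be fixed before \<open>w\<close>, while the set of
  tight monomials of g_j varies with \<open>w\<close>. It is therefore imposed on every nonempty set
  of monomials of g_j, through a single polynomial in the coefficients.\<close>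

abbreviation "keys \<equiv> Poly_Mapping.keys"
abbreviation "lookup \<equiv> Poly_Mapping.lookup"
abbreviation "single \<equiv> Poly_Mapping.single"

section \<open>Evaluation of polynomials\<close>

lemma poly_mapping_sum_single:
  fixes p :: "'a \<Rightarrow>\<^sub>0 'b::comm_monoid_add"
  shows "p = (\<Sum>a\<in>keys p. single a (lookup p a))"
proof (rule poly_mapping_eqI)
  fix k
  show "lookup p k = lookup (\<Sum>a\<in>keys p. single a (lookup p a)) k"
    by (simp add: lookup_sum lookup_single when_def not_in_keys_iff_lookup_eq_zero)
qed

text \<open>Linear extension of \<open>e\<close> from monomials to polynomials. The one notion
  serves for evaluation, for reading off a coefficient (\<open>e\<close> an indicator), and for
  evaluating only the terms of a given weight.\<close>

definition term_sum :: "('a \<Rightarrow> 'b) \<Rightarrow> ('a \<Rightarrow>\<^sub>0 'b::comm_ring_1) \<Rightarrow> 'b" where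
  "term_sum e p = (\<Sum>a\<in>keys p. lookup p a * e a)"

lemma term_sum_superset:
  assumes "finite A" "keys p \<subseteq> A"
  shows "term_sum e p = (\<Sum>a\<in>A. lookup p a * e a)"
  unfolding term_sum_def using assms
  by (intro sum.mono_neutral_left) (auto simp: not_in_keys_iff_lookup_eq_zero)

lemma term_sum_zero [simp]: "term_sum e 0 = 0"
  by (simp add: term_sum_def)

lemma term_sum_add: "term_sum e (p + q) = term_sum e p + term_sum e q"
  using term_sum_superset[of "keys p \<union> keys q" p e] term_sum_superset[of "keys p \<union> keys q" q e]
    term_sum_superset[of "keys p \<union> keys q" "p + q" e] keys_add[of p q]
  by (simp add: lookup_add distrib_right sum.distrib)

lemma term_sum_sum: "term_sum e (\<Sum>i\<in>A. p i) = (\<Sum>i\<in>A. term_sum e (p i))"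
  by (induction A rule: infinite_finite_induct) (auto simp: term_sum_add)

lemma term_sum_single [simp]: "term_sum e (single a x) = x * e a"
  by (cases "x = 0") (auto simp: term_sum_def)

lemma term_sum_mult:
  fixes h f :: "('a::monoid_add) \<Rightarrow>\<^sub>0 ('b::comm_ring_1)"
  shows "term_sum e (h * f) = (\<Sum>k\<in>keys h. lookup h k * term_sum (\<lambda>l. e (k + l)) f)"
proof -
  have "h * f = (\<Sum>k\<in>keys h. single k (lookup h k)) * (\<Sum>l\<in>keys f. single l (lookup f l))"
    using poly_mapping_sum_single[of h] poly_mapping_sum_single[of f] by simp
  also have "\<dots> = (\<Sum>k\<in>keys h. \<Sum>l\<in>keys f. single (k + l) (lookup h k * lookup f l))"
    by (simp add: sum_product mult_single)
  finally show ?thesis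
    by (simp add: term_sum_sum) (simp add: term_sum_def sum_distrib_left mult.assoc)
qed

definition mono_eval :: "('v \<Rightarrow> complex) \<Rightarrow> 'v mono \<Rightarrow> complex" where
  "mono_eval x a = (\<Prod>v\<in>keys a. x v ^ lookup a v)"

lemma mono_eval_superset:
  assumes "finite A" "keys a \<subseteq> A"
  shows "mono_eval x a = (\<Prod>v\<in>A. x v ^ lookup a v)"
  unfolding mono_eval_def using assms
  by (intro prod.mono_neutral_left) (auto simp: not_in_keys_iff_lookup_eq_zero)

lemma mono_eval_add: "mono_eval x (a + b) = mono_eval x a * mono_eval x b"
  using mono_eval_superset[of "keys a \<union> keys b" a x] mono_eval_superset[of "keys a \<union> keys b" b x]
    mono_eval_superset[of "keys a \<union> keys b" "a + b" x] keys_add[of a b]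
  by (simp add: lookup_add power_add prod.distrib)

lemma poly_eval_eq_term_sum: "poly_eval p x = term_sum (mono_eval x) p"
  by (simp add: poly_eval_def term_sum_def mono_eval_def)

lemma poly_eval_simps [simp]:
  "poly_eval 0 x = 0"
  "poly_eval (p + q) x = poly_eval p x + poly_eval q x"
  "poly_eval (p * q) x = poly_eval p x * poly_eval q x"
  "poly_eval (monomial a) x = mono_eval x a"
  "poly_eval (var v) x = x v"
  "poly_eval 1 x = 1"
proof -
  show "poly_eval (p * q) x = poly_eval p x * poly_eval q x"
    unfolding poly_eval_eq_term_sum term_sum_mult mono_eval_add
    unfolding term_sum_def sum_product by (simp add: sum_distrib_left ac_simps)
  have "(1 :: 'a mpoly) = single 0 1" by simp
  then show "poly_eval 1 x = 1"
    unfolding poly_eval_eq_term_sum by (simp add: term_sum_def mono_eval_def)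
qed (auto simp: poly_eval_eq_term_sum term_sum_add monomial_def var_def mono_eval_def)

lemma poly_eval_sum: "poly_eval (\<Sum>i\<in>A. p i) x = (\<Sum>i\<in>A. poly_eval (p i) x)"
  by (induction A rule: infinite_finite_induct) auto

lemma poly_eval_prod: "poly_eval (\<Prod>i\<in>A. p i) x = (\<Prod>i\<in>A. poly_eval (p i) x)"
  by (induction A rule: infinite_finite_induct) auto

section \<open>Weights of monomials\<close>

lemma mweight_UNIV:
  fixes a :: "'v::finite mono"
  shows "mweight \<omega> a = (\<Sum>v\<in>UNIV. of_nat (lookup a v) * \<omega> v)"
  unfolding mweight_def by (intro sum.mono_neutral_left) (auto simp: not_in_keys_iff_lookup_eq_zero)

lemma mweight_add:
  fixes a b :: "'v::finite mono"
  shows "mweight \<omega> (a + b) = mweight \<omega> a + mweight \<omega> b"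
  by (simp add: mweight_UNIV lookup_add distrib_right sum.distrib)

lemma mweight_uminus: "mweight (\<lambda>v. - \<omega> v) a = - mweight \<omega> a"
  by (simp add: mweight_def sum_negf)

lemma finite_bounded_monos: "finite {a :: 'v::finite mono. \<forall>v. lookup a v \<le> N}"
proof -
  have "lookup ` {a :: 'v mono. \<forall>v. lookup a v \<le> N} \<subseteq> {f. \<forall>v. f v \<in> {..N}}"
    by auto
  moreover have "finite {f :: 'v \<Rightarrow> nat. \<forall>v. f v \<in> {..N}}"
    using finite_set_of_finite_funs[of "UNIV :: 'v set" "{..N}"] by simp
  ultimately have "finite (lookup ` {a :: 'v mono. \<forall>v. lookup a v \<le> N})"
    by (rule finite_subset)
  then show ?thesis
    by (rule finite_imageD) (auto intro: inj_onI poly_mapping_eqI)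
qed

text \<open>Each summand of the weight is nonpositive, so a lower bound on the total bounds every
  exponent. This finiteness takes the place of well-foundedness in
  \<open>standard_representation\<close>.\<close>

lemma finite_mweight_ge:
  fixes \<omega> :: "'v::finite \<Rightarrow> real"
  assumes "\<And>v. \<omega> v < 0"
  shows "finite {a. mweight \<omega> a \<ge> C}"
proof -
  define N where "N = nat \<lceil>Max (range (\<lambda>v. C / \<omega> v))\<rceil>"
  have "lookup a v \<le> N" if "mweight \<omega> a \<ge> C" for a v
  proof -
    have "C \<le> mweight \<omega> a" by fact
    also have "mweight \<omega> a = of_nat (lookup a v) * \<omega> v + (\<Sum>v\<in>UNIV - {v}. of_nat (lookup a v) * \<omega> v)"
      unfolding mweight_UNIV by (simp add: sum.remove[of UNIV v])
    also have "\<dots> \<le> of_nat (lookup a v) * \<omega> v"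
      using assms by (simp add: sum_nonpos mult_nonneg_nonpos less_imp_le)
    finally have "real (lookup a v) \<le> C / \<omega> v"
      using assms[of v] by (simp add: field_simps)
    also have "\<dots> \<le> Max (range (\<lambda>v. C / \<omega> v))"
      by (intro Max_ge) auto
    finally show ?thesis unfolding N_def by linarith
  qed
  then show ?thesis
    by (intro finite_subset[OF _ finite_bounded_monos[of N]]) auto
qed

section \<open>Ideals and leading monomials\<close>

lemma module_mult: "module ((*) :: 'v mpoly \<Rightarrow> _)"
  by unfold_locales (auto simp: algebra_simps)

lemma ideal_gen_eq_span: "ideal_gen = module.span (*)"
  by (rule ext) (auto simp: ideal_gen_def module.span_explicit[OF module_mult])

lemmas ideal_gen_base = module.span_base[OF module_mult, folded ideal_gen_eq_span]
lemmas ideal_gen_scale = module.span_scale[OF module_mult, folded ideal_gen_eq_span]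
lemmas ideal_gen_idem = module.span_span[OF module_mult, folded ideal_gen_eq_span]
lemmas ideal_gen_mono = module.span_mono[OF module_mult, folded ideal_gen_eq_span]

lemma ideal_gen_minimal:
  assumes "A \<subseteq> ideal_gen B"
  shows "ideal_gen A \<subseteq> ideal_gen B"
  using ideal_gen_mono[OF assms] by (simp add: ideal_gen_idem)

lemma ideal_gen_induct [consumes 1, case_names zero add]:
  assumes "p \<in> ideal_gen G" "Q 0" "\<And>h g p. g \<in> G \<Longrightarrow> Q p \<Longrightarrow> Q (h * g + p)"
  shows "Q p"
proof -
  obtain S h where "finite S" "S \<subseteq> G" "p = (\<Sum>g\<in>S. h g * g)"
    using assms(1) by (auto simp: ideal_gen_def)
  from this(1,2) have "Q (\<Sum>g\<in>S. h g * g)"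
    by (induction S) (use assms in auto)
  with \<open>p = _\<close> show ?thesis by simp
qed

lemma ideal_gen_image_lessThan:
  assumes "p \<in> ideal_gen {f j | j. j < (c::nat)}"
  shows "\<exists>h. p = (\<Sum>j<c. h j * f j)"
  using assms
proof (induction rule: ideal_gen_induct)
  case zero
  show ?case by (intro exI[of _ "\<lambda>_. 0"]) simp
next
  case (add h g p)
  then obtain h' j where "p = (\<Sum>j<c. h' j * f j)" and j: "j < c" "g = f j" by blast
  then have "h * g + p = (\<Sum>i<c. (h' i + (if i = j then h else 0)) * f i)"
    by (simp add: distrib_right sum.distrib if_distrib[of "\<lambda>x. x * _"] sum.delta cong: if_cong)
  then show ?case by (intro exI)
qed

lemma monomial_ideal_keys:
  assumes "p \<in> ideal_gen (monomial ` E)" "a \<in> keys p"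
  shows "\<exists>e\<in>E. \<exists>b. a = b + e"
  using assms
proof (induction rule: ideal_gen_induct)
  case (add h g p)
  have "a \<in> keys (h * g) \<or> a \<in> keys p" using add.prems keys_add[of "h * g" p] by blast
  then show ?case
  proof
    assume "a \<in> keys (h * g)"
    then obtain k l where "a = k + l" "l \<in> keys g" using keys_mult[of h g] by blast
    then show ?thesis using add.hyps by (auto simp: monomial_def)
  qed (use add in blast)
qed simp

section \<open>Leading monomials for a monomial order\<close>

context
  fixes gt :: "'v mono \<Rightarrow> 'v mono \<Rightarrow> bool"
  assumes mo: "monomial_order gt"
begin

lemma gt_irrefl: "\<not> gt a a" and gt_trans: "gt a b \<Longrightarrow> gt b d \<Longrightarrow> gt a d"
  and gt_total: "a \<noteq> b \<Longrightarrow> gt a b \<or> gt b a" and gt_add: "gt a b \<Longrightarrow> gt (a + d) (b + d)"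
  using mo unfolding monomial_order_def by blast+

lemma gt_max_exists:
  assumes "finite A" "A \<noteq> {}"
  shows "\<exists>a\<in>A. \<forall>b\<in>A. b \<noteq> a \<longrightarrow> gt a b"
  using assms
proof (induction rule: finite_ne_induct)
  case (insert x A)
  then obtain a where "a \<in> A" "\<forall>b\<in>A. b \<noteq> a \<longrightarrow> gt a b" by blast
  then show ?case
    using gt_trans gt_total insert.hyps by (metis insert_iff)
qed simp

lemma lead_mono_eqI:
  assumes "a \<in> keys p" "\<And>b. b \<in> keys p \<Longrightarrow> b \<noteq> a \<Longrightarrow> gt a b"
  shows "lead_mono gt p = a"
  unfolding lead_mono_def
proof (rule the_equality)
  show "a' = a" if "a' \<in> keys p \<and> (\<forall>b\<in>keys p. b \<noteq> a' \<longrightarrow> gt a' b)" for a'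
    using assms that gt_trans[of a a' a] gt_irrefl[of a] by metis
qed (use assms in blast)

lemma lead_mono:
  assumes "p \<noteq> 0"
  shows "lead_mono gt p \<in> keys p" "b \<in> keys p \<Longrightarrow> b \<noteq> lead_mono gt p \<Longrightarrow> gt (lead_mono gt p) b"
proof -
  obtain a where "a \<in> keys p" "\<forall>b\<in>keys p. b \<noteq> a \<longrightarrow> gt a b"
    using gt_max_exists[of "keys p"] assms by auto
  with lead_mono_eqI[of a p]
  show "lead_mono gt p \<in> keys p" "b \<in> keys p \<Longrightarrow> b \<noteq> lead_mono gt p \<Longrightarrow> gt (lead_mono gt p) b" by auto
qed

end

lemma monomial_order_weight:
  fixes \<omega> :: "'v::finite \<Rightarrow> real"
  assumes mo: "monomial_order gt"
  shows "monomial_order (weight_order \<omega> gt)"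
  unfolding monomial_order_def
proof (intro conjI allI impI)
  show "\<not> weight_order \<omega> gt a a" for a
    using gt_irrefl[OF mo] by (simp add: weight_order_def)
  show "weight_order \<omega> gt a d" if "weight_order \<omega> gt a b" "weight_order \<omega> gt b d" for a b d
    using that gt_trans[OF mo, of a b d] unfolding weight_order_def by linarith
  show "weight_order \<omega> gt a b \<or> weight_order \<omega> gt b a" if "a \<noteq> b" for a b
    using gt_total[OF mo that] unfolding weight_order_def by linarith
  show "weight_order \<omega> gt (a + d) (b + d)" if "weight_order \<omega> gt a b" for a b d
    using that gt_add[OF mo, of a b d] unfolding weight_order_def mweight_add by linarith
qed

lemma coprime_monos_common_multiple:
  fixes m m' :: "'v mono"
  assumes "k + m = k' + m'" "\<And>v. lookup m v = 0 \<or> lookup m' v = 0"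
  shows "\<exists>d. k = d + m'"
proof
  \<comment> \<open>Truncated subtraction of exponents is exact here: where \<open>m\<close> has
    exponent 0, the equation makes \<open>k\<close> at least as large as \<open>m'\<close>, and
    elsewhere \<open>m'\<close> has exponent 0.\<close>
  show "k = (k - m') + m'"
  proof (rule poly_mapping_eqI)
    fix v
    have "lookup k v + lookup m v = lookup k' v + lookup m' v"
      using assms(1) by (metis lookup_add)
    with assms(2)[of v] show "lookup k v = lookup (k - m' + m') v"
      by (auto simp: lookup_add lookup_minus)
  qed
qed

lemma lookup_mult_monomial: "lookup (h * monomial m) (b + m) = lookup h b"
proof -
  have "lookup (h * monomial m) (b + m) = term_sum (\<lambda>x. if x = b + m then 1 else 0) (h * monomial m)"
    by (auto simp: term_sum_def if_distrib[of "\<lambda>x. _ * x"] not_in_keys_iff_lookup_eq_zero cong: if_cong)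
  also have "\<dots> = lookup h b"
    unfolding term_sum_mult monomial_def
    by (auto simp: if_distrib[of "\<lambda>x. _ * x"] not_in_keys_iff_lookup_eq_zero cong: if_cong)
  finally show ?thesis .
qed

text \<open>The cancellation of the top terms is a syzygy of pairwise coprime monomials, hence a
  combination of Koszul syzygies. Rewriting along these lowers the top monomial; since only
  finitely many monomials exceed the leading monomial of the given element, this stops.\<close>

lemma standard_representation:
  fixes gt :: "'v mono \<Rightarrow> 'v mono \<Rightarrow> bool" and m :: "nat \<Rightarrow> 'v mono" and q :: "nat \<Rightarrow> 'v mpoly"
  assumes mo: "monomial_order gt"
    and fin: "\<And>a. finite {b. gt b a}"
    and lower: "\<And>j b. j < c \<Longrightarrow> b \<in> keys (q j) \<Longrightarrow> gt (m j) b"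
    and coprime: "\<And>i j v. i < c \<Longrightarrow> j < c \<Longrightarrow> i \<noteq> j \<Longrightarrow> lookup (m i) v = 0 \<or> lookup (m j) v = 0"
    and p: "p = (\<Sum>j<c. h j * (monomial (m j) + q j))"
    and a: "\<And>b. b \<in> keys p \<Longrightarrow> b = a \<or> gt a b"
  shows "\<exists>h. p = (\<Sum>j<c. h j * (monomial (m j) + q j)) \<and>
           (\<forall>j<c. \<forall>k\<in>keys (h j * monomial (m j)). k = a \<or> gt a k)"
  using p
\<comment> \<open>The measure counts every monomial above \<open>a\<close> that lies at or below an
  occurring one, not just the occurring ones: rewriting may create new monomials below the top, and
  these are counted already.\<close>
proof (induction "card {b. gt b a \<and> (\<exists>j<c. \<exists>k\<in>keys (h j * monomial (m j)). k = b \<or> gt k b)}"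
    arbitrary: h rule: less_induct)
  case (less h)
  define H where "H h = {b. gt b a \<and> (\<exists>j<c. \<exists>k\<in>keys (h j * monomial (m j)). k = b \<or> gt k b)}"
    for h :: "nat \<Rightarrow> 'v mpoly"
  define K where "K = (\<Union>j<c. keys (h j * monomial (m j)))"
  note irrefl = gt_irrefl[OF mo] and trans = gt_trans[OF mo] and total = gt_total[OF mo]
    and add = gt_add[OF mo]
  have add': "gt (d + a) (d + b)" if "gt a b" for a b d
    using add[OF that, of d] by (simp add: add.commute)
  show ?case
  proof (cases "\<exists>k\<in>K. gt k a")
    case False
    then show ?thesis
      using less.prems total unfolding K_def by (intro exI[of _ h]) blast
  next
    case True
    have "finite K" unfolding K_def by simp
    with True obtain \<mu> where \<mu>: "\<mu> \<in> K" "\<And>k. k \<in> K \<Longrightarrow> k \<noteq> \<mu> \<Longrightarrow> gt \<mu> k"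
      using gt_max_exists[OF mo, of K] by blast
    then have \<mu>a: "gt \<mu> a" using True trans by metis
    define e where "e j = lookup (h j * monomial (m j)) \<mu>" for j
    have low_mult: "gt \<mu> k" if k: "k \<in> keys (h j * q j)" and j: "j < c" for j k
    proof -
      obtain b l where bl: "k = b + l" "b \<in> keys (h j)" "l \<in> keys (q j)"
        using k keys_mult by blast
      then have "lookup (h j * monomial (m j)) (b + m j) \<noteq> 0"
        by (simp add: lookup_mult_monomial in_keys_iff)
      then have "b + m j \<in> K" unfolding K_def using j by (auto simp: in_keys_iff)
      moreover have "gt (b + m j) k" using lower[OF j bl(3)] bl(1) add' by simp
      ultimately show ?thesis using \<mu>(2) trans by metis
    qed
    have "lookup p \<mu> = 0"
      using a[of \<mu>] \<mu>a irrefl trans by (metis not_in_keys_iff_lookup_eq_zero)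
    moreover have "lookup (h j * q j) \<mu> = 0" if "j < c" for j
      using low_mult[OF _ that] irrefl by (metis not_in_keys_iff_lookup_eq_zero)
    \<comment> \<open>\<open>\<mu>\<close> is above every monomial of \<open>p\<close> and of the
      products with the tails \<open>q j\<close>, so the coefficients of the
      \<open>h j * monomial (m j)\<close> at \<open>\<mu>\<close> must cancel among
      themselves.\<close>
    ultimately have sum_e: "(\<Sum>j<c. e j) = 0"
      using less.prems by (simp add: lookup_sum distrib_left lookup_add e_def sum.distrib)
    have mult: "\<exists>k. \<mu> = k + m j" if "e j \<noteq> 0" for j
    proof -
      have "\<mu> \<in> keys (h j * monomial (m j))" using that by (simp add: e_def in_keys_iff)
      then obtain k l where "\<mu> = k + l" "l \<in> keys (monomial (m j))" using keys_mult by blast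
      then show ?thesis by (auto simp: monomial_def)
    qed
    obtain j0 where j0: "j0 < c" "e j0 \<noteq> 0"
      using \<mu>(1) unfolding K_def e_def by (auto simp: in_keys_iff)
    have "\<exists>d. \<mu> = d + m j0 + m j" if j: "j < c" "j \<noteq> j0" "e j \<noteq> 0" for j
    proof -
      obtain k k' where k: "\<mu> = k + m j" "\<mu> = k' + m j0" using mult[OF j(3)] mult[OF j0(2)] by blast
      have "\<exists>d. k = d + m j0"
        by (rule coprime_monos_common_multiple[of k "m j" k' "m j0"])
          (use k coprime[OF j(1) j0(1) j(2)] in auto)
      then obtain d where "k = d + m j0" ..
      with k show ?thesis by blast
    qed
    then obtain d where d: "\<And>j. j < c \<Longrightarrow> j \<noteq> j0 \<Longrightarrow> e j \<noteq> 0 \<Longrightarrow> \<mu> = d j + m j0 + m j"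
      by metis
    define T where "T = {..<c} - {j0}"
    define f where "f j = monomial (m j) + q j" for j
    define s where "s j = single (d j) (e j)" for j
    \<comment> \<open>For each \<open>j\<close> in \<open>T\<close> the trivial relation
      \<open>f j * f j0 - f j0 * f j = 0\<close> is added with multiplier \<open>s j\<close>. This
      clears \<open>\<mu>\<close> from the product at \<open>j\<close>, and at the pivot
      \<open>j0\<close> because the \<open>e j\<close> sum to zero. If \<open>e j = 0\<close>, then
      \<open>d j\<close> is arbitrary but \<open>s j = 0\<close>.\<close>
    define h' where "h' j = (if j = j0 then h j0 + (\<Sum>i\<in>T. s i * f i) else h j - s j * f j0)" for j
    have T: "{..<c} = insert j0 T" "finite T" "j0 \<notin> T" using j0 by (auto simp: T_def)
    have "(\<Sum>j<c. h' j * f j) = h' j0 * f j0 + (\<Sum>j\<in>T. h' j * f j)"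
      using T by simp
    also have "(\<Sum>j\<in>T. h' j * f j) = (\<Sum>j\<in>T. h j * f j - s j * f j0 * f j)"
      using T by (intro sum.cong) (auto simp: h'_def algebra_simps)
    also have "h' j0 * f j0 + \<dots> = (\<Sum>j<c. h j * f j)"
      using T by (simp add: h'_def algebra_simps sum_subtractf sum_distrib_left)
    finally have p': "p = (\<Sum>j<c. h' j * f j)" using less.prems by (simp add: f_def)
    have s_mono: "s j * monomial (m i) * monomial (m j0) = single \<mu> (e j)"
      "s j * monomial (m j0) * monomial (m j) = single \<mu> (e j)"
      if "j \<in> T" "i = j" for i j
      using d[of j] that by (cases "e j = 0"; simp add: T_def s_def monomial_def mult_single ac_simps)+
    have s_low: "gt \<mu> k" if j: "j \<in> T" "i = j \<and> i' = j0 \<or> i = j0 \<and> i' = j"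
      "k \<in> keys (s j * q i * monomial (m i'))" for i i' j k
    proof -
      have "e j \<noteq> 0" using j(3) by (auto simp: s_def)
      then have \<mu>_eq: "\<mu> = d j + m j0 + m j" using d j(1) by (auto simp: T_def)
      obtain x y where "k = x + y" "x \<in> keys (s j * q i)" "y \<in> keys (monomial (m i'))"
        using j(3) keys_mult by blast
      moreover obtain x1 x2 where "x = x1 + x2" "x1 \<in> keys (s j)" "x2 \<in> keys (q i)"
        using calculation(2) keys_mult by blast
      ultimately have k: "k = d j + x2 + m i'" "x2 \<in> keys (q i)"
        using \<open>e j \<noteq> 0\<close> by (auto simp: s_def monomial_def)
      have "i < c" using j(1,2) j0 by (auto simp: T_def)
      then have "gt (d j + m i + m i') k"
        unfolding k(1) using add[OF add'[OF lower[OF _ k(2)]]] by blast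
      then show ?thesis using j(2) \<mu>_eq by (auto simp: ac_simps)
    qed
    have low: "gt \<mu> k" if j: "j < c" and k: "k \<in> keys (h' j * monomial (m j))" for j k
    proof -
      define R where "R = h j * monomial (m j) - single \<mu> (e j)"
      have R: "gt \<mu> k" if "k \<in> keys R" for k
      proof -
        have "lookup R \<mu> = 0" by (simp add: R_def lookup_minus e_def)
        then have "k \<noteq> \<mu>" using that by (auto simp: in_keys_iff)
        moreover have "k \<in> K"
        proof -
          have "lookup R k \<noteq> 0" using that by (simp add: in_keys_iff)
          then have "lookup (h j * monomial (m j)) k \<noteq> 0"
            using \<open>k \<noteq> \<mu>\<close> by (simp add: R_def lookup_minus lookup_single)
          then show ?thesis using j by (auto simp: K_def in_keys_iff)
        qed
        ultimately show ?thesis using \<mu>(2) by blast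
      qed
      show ?thesis
      proof (cases "j = j0")
        case True
        have "(\<Sum>i\<in>T. s i * f i * monomial (m j0)) =
          (\<Sum>i\<in>T. single \<mu> (e i)) + (\<Sum>i\<in>T. s i * q i * monomial (m j0))"
          by (simp add: f_def distrib_left distrib_right sum.distrib s_mono)
        moreover have "(\<Sum>i\<in>T. single \<mu> (e i)) = single \<mu> (\<Sum>i\<in>T. e i)"
          by (induction T rule: infinite_finite_induct) (auto simp: single_add)
        moreover have "(\<Sum>i\<in>T. e i) = - e j0"
          using sum_e T by (simp add: add_eq_0_iff2)
        ultimately have "h' j * monomial (m j) = R + (\<Sum>i\<in>T. s i * q i * monomial (m j0))"
          using True by (simp add: h'_def R_def distrib_right sum_distrib_right single_uminus)
        with k have "k \<in> keys R \<or> k \<in> keys (\<Sum>i\<in>T. s i * q i * monomial (m j0))"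
          using keys_add by fastforce
        then show ?thesis
        proof
          assume "k \<in> keys (\<Sum>i\<in>T. s i * q i * monomial (m j0))"
          then obtain i where i: "i \<in> T" "k \<in> keys (s i * q i * monomial (m j0))"
            using keys_sum by fastforce
          show ?thesis by (rule s_low[OF i(1) _ i(2)]) simp
        qed (rule R)
      next
        case False
        then have "j \<in> T" using j by (simp add: T_def)
        have "h' j * monomial (m j) = R - s j * q j0 * monomial (m j)"
          using False s_mono(2)[OF \<open>j \<in> T\<close> refl]
          by (simp add: h'_def R_def f_def left_diff_distrib distrib_left distrib_right diff_diff_eq)
        with k have "k \<in> keys R \<or> k \<in> keys (s j * q j0 * monomial (m j))"
          using keys_diff by fastforce
        then show ?thesis using R s_low[OF \<open>j \<in> T\<close>] by blast
      qed
    qed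
    have "H h' \<subseteq> H h"
    proof
      fix b assume "b \<in> H h'"
      then obtain j k where "gt b a" "j < c" "k \<in> keys (h' j * monomial (m j))" "k = b \<or> gt k b"
        unfolding H_def by blast
      then have "gt \<mu> b" using low trans by metis
      then show "b \<in> H h" using \<open>gt b a\<close> \<mu>(1) unfolding H_def K_def by blast
    qed
    moreover have "\<mu> \<in> H h" using \<mu>(1) \<mu>a unfolding H_def K_def by blast
    moreover have "\<mu> \<notin> H h'"
    proof
      assume "\<mu> \<in> H h'"
      then obtain j k where "j < c" "k \<in> keys (h' j * monomial (m j))" "k = \<mu> \<or> gt k \<mu>"
        unfolding H_def by blast
      then show False using low[of j k] irrefl trans by metis
    qed
    moreover have "finite (H h)"
      unfolding H_def by (rule finite_subset[OF _ fin[of a]]) blast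
    ultimately have "card (H h') < card (H h)" by (intro psubset_card_mono) auto
    then show ?thesis
      using less.hyps[of h'] p' unfolding H_def f_def by blast
  qed
qed

text \<open>The product criterion for coprime leading monomials. In a representation where no
  product exceeds the leading monomial \<open>a\<close> of \<open>p\<close>, a tail term cannot
  produce \<open>a\<close>, because the same multiple of \<open>m j\<close> would exceed it; so some
  \<open>m j\<close> divides \<open>a\<close>.\<close>

lemma lead_ideal_coprime:
  fixes gt :: "'v mono \<Rightarrow> 'v mono \<Rightarrow> bool" and m :: "nat \<Rightarrow> 'v mono" and q :: "nat \<Rightarrow> 'v mpoly"
  assumes mo: "monomial_order gt"
    and fin: "\<And>a. finite {b. gt b a}"
    and lower: "\<And>j b. j < c \<Longrightarrow> b \<in> keys (q j) \<Longrightarrow> gt (m j) b"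
    and coprime: "\<And>i j v. i < c \<Longrightarrow> j < c \<Longrightarrow> i \<noteq> j \<Longrightarrow> lookup (m i) v = 0 \<or> lookup (m j) v = 0"
  shows "lead_ideal gt (ideal_gen {monomial (m j) + q j | j. j < c}) = ideal_gen {monomial (m j) | j. j < c}"
    (is "lead_ideal gt ?I = ideal_gen ?M")
proof
  note irrefl = gt_irrefl[OF mo] and trans = gt_trans[OF mo]
  show "lead_ideal gt ?I \<subseteq> ideal_gen ?M"
    unfolding lead_ideal_def
  proof (rule ideal_gen_minimal, safe)
    fix p assume p: "p \<in> ?I" "p \<noteq> 0"
    define a where "a = lead_mono gt p"
    have a: "a \<in> keys p" "\<And>b. b \<in> keys p \<Longrightarrow> b = a \<or> gt a b"
      using lead_mono[OF mo p(2)] unfolding a_def by blast+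
    obtain h0 where "p = (\<Sum>j<c. h0 j * (monomial (m j) + q j))"
      using ideal_gen_image_lessThan[OF p(1)] by blast
    from standard_representation[OF mo fin lower coprime this a(2)]
    obtain h where h: "p = (\<Sum>j<c. h j * (monomial (m j) + q j))"
      "\<And>j k. j < c \<Longrightarrow> k \<in> keys (h j * monomial (m j)) \<Longrightarrow> k = a \<or> gt a k" by blast
    obtain j where j: "j < c" "a \<in> keys (h j * (monomial (m j) + q j))"
      using a(1) keys_sum[of "\<lambda>j. h j * (monomial (m j) + q j)" "{..<c}"] unfolding h(1) by blast
    then obtain k l where kl: "a = k + l" "k \<in> keys (h j)" "l \<in> keys (monomial (m j) + q j)"
      using keys_mult[of "h j" "monomial (m j) + q j"] by blast
    have "k + m j \<in> keys (h j * monomial (m j))"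
      using kl(2) by (simp add: in_keys_iff lookup_mult_monomial)
    then have top: "k + m j = a \<or> gt a (k + m j)" using h(2) j(1) by blast
    have "l \<in> keys (monomial (m j)) \<or> l \<in> keys (q j)"
      using kl(3) keys_add[of "monomial (m j)" "q j"] by blast
    moreover have "\<not> gt (m j) l"
    proof
      assume "gt (m j) l"
      then have "gt (k + m j) a" using gt_add[OF mo, of "m j" l k] kl(1) by (simp add: add.commute)
      with top show False using irrefl trans by metis
    qed
    ultimately have "l = m j" using lower[OF j(1)] by (auto simp: monomial_def)
    then have "monomial a = monomial k * monomial (m j)"
      using kl(1) by (simp add: monomial_def mult_single)
    then show "monomial (lead_mono gt p) \<in> ideal_gen ?M"
      unfolding a_def[symmetric] using j(1) ideal_gen_scale[OF ideal_gen_base[of "monomial (m j)" ?M]]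
      by auto
  qed
  show "ideal_gen ?M \<subseteq> lead_ideal gt ?I"
    unfolding lead_ideal_def
  proof (rule ideal_gen_mono, safe)
    fix j assume j: "j < c"
    have "m j \<notin> keys (q j)" using lower[OF j] irrefl by blast
    then have "lookup (monomial (m j) + q j) (m j) = 1"
      by (simp add: lookup_add monomial_def not_in_keys_iff_lookup_eq_zero)
    then have mem: "m j \<in> keys (monomial (m j) + q j)" by (simp add: in_keys_iff)
    have "lead_mono gt (monomial (m j) + q j) = m j"
    proof (rule lead_mono_eqI[OF mo mem])
      fix b assume b: "b \<in> keys (monomial (m j) + q j)" "b \<noteq> m j"
      then have "b \<in> keys (q j)"
        using keys_add[of "monomial (m j)" "q j"] by (auto simp: monomial_def)
      then show "gt (m j) b" using lower[OF j] by blast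
    qed
    moreover have "monomial (m j) + q j \<noteq> 0" using mem by force
    moreover have "monomial (m j) + q j \<in> ?I" using j by (auto intro: ideal_gen_base)
    ultimately show "\<exists>p. monomial (m j) = monomial (lead_mono gt p) \<and> p \<in> ?I \<and> p \<noteq> 0"
      by (intro exI[of _ "monomial (m j) + q j"]) simp
  qed
qed

text \<open>By the standard representation, the lightest part of an element of the ideal is a
  combination of the parts of the generators of weight \<open>mweight \<omega> (m j)\<close>. These
  vanish at the torus point \<open>z\<close>, where no monomial does.\<close>

lemma init_ideal_no_monomial:
  fixes gt :: "'v::finite mono \<Rightarrow> 'v mono \<Rightarrow> bool" and m :: "nat \<Rightarrow> 'v mono" and q :: "nat \<Rightarrow> 'v mpoly"
    and \<omega> :: "'v \<Rightarrow> real"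
  assumes mo: "monomial_order gt"
    and \<omega>: "\<And>v. \<omega> v > 0"
    and lower: "\<And>j b. j < c \<Longrightarrow> b \<in> keys (q j) \<Longrightarrow>
          mweight \<omega> (m j) < mweight \<omega> b \<or> mweight \<omega> (m j) = mweight \<omega> b \<and> gt (m j) b"
    and coprime: "\<And>i j v. i < c \<Longrightarrow> j < c \<Longrightarrow> i \<noteq> j \<Longrightarrow> lookup (m i) v = 0 \<or> lookup (m j) v = 0"
    and z: "\<And>v. z v \<noteq> 0"
    and zero: "\<And>j. j < c \<Longrightarrow> term_sum
          (\<lambda>b. if mweight \<omega> b = mweight \<omega> (m j) then mono_eval z b else 0) (monomial (m j) + q j) = 0"
  shows "monomial a \<notin> init_ideal \<omega> (ideal_gen {monomial (m j) + q j | j. j < c})"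
proof
  let ?I = "ideal_gen {monomial (m j) + q j | j. j < c}"
  \<comment> \<open>Initial forms take minimal weight while \<open>weight_order\<close> puts larger
    weight first, hence the sign; positive \<open>\<omega>\<close> then gives the required
    finiteness.\<close>
  define gt' where "gt' = weight_order (\<lambda>v. - \<omega> v) gt"
  have gt'_eq: "gt' a b \<longleftrightarrow> mweight \<omega> a < mweight \<omega> b \<or> mweight \<omega> a = mweight \<omega> b \<and> gt a b" for a b
    unfolding gt'_def weight_order_def mweight_uminus by auto
  have mo': "monomial_order gt'" unfolding gt'_def by (rule monomial_order_weight[OF mo])
  have fin': "finite {b. gt' b a}" for a
  proof (rule finite_subset)
    show "{b. gt' b a} \<subseteq> {b. mweight (\<lambda>v. - \<omega> v) b \<ge> mweight (\<lambda>v. - \<omega> v) a}"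
      unfolding gt'_def weight_order_def by auto
  qed (rule finite_mweight_ge, use \<omega> in simp)
  have lower': "gt' (m j) b" if "j < c" "b \<in> keys (q j)" for j b
    using lower[OF that] unfolding gt'_eq .
  have eval: "poly_eval (init_form \<omega> p) z = 0" if p: "p \<in> ?I" for p
  proof (cases "p = 0")
    case True
    then show ?thesis by (simp add: init_form_def)
  next
    case False
    define a where "a = lead_mono gt' p"
    have a: "a \<in> keys p" "\<And>b. b \<in> keys p \<Longrightarrow> b = a \<or> gt' a b"
      using lead_mono[OF mo' False] unfolding a_def by blast+
    define W where "W = mweight \<omega> a"
    have Min: "Min (mweight \<omega> ` keys p) = W"
      unfolding W_def using a gt'_eq by (intro Min_eqI) force+
    obtain h0 where "p = (\<Sum>j<c. h0 j * (monomial (m j) + q j))"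
      using ideal_gen_image_lessThan[OF p] by blast
    from standard_representation[OF mo' fin' lower' coprime this a(2)]
    obtain h where h: "p = (\<Sum>j<c. h j * (monomial (m j) + q j))"
      "\<And>j k. j < c \<Longrightarrow> k \<in> keys (h j * monomial (m j)) \<Longrightarrow> k = a \<or> gt' a k" by blast
    define e where "e V b = (if mweight \<omega> b = V then mono_eval z b else 0)" for V b
    have "poly_eval (init_form \<omega> p) z = (\<Sum>b\<in>{b\<in>keys p. mweight \<omega> b = W}. lookup p b * mono_eval z b)"
      unfolding init_form_def Min by (simp add: poly_eval_sum) (simp add: poly_eval_eq_term_sum)
    also have "\<dots> = term_sum (e W) p"
      unfolding term_sum_def e_def by (simp add: sum.inter_filter if_distrib[of "\<lambda>x. _ * x"] cong: if_cong)
    also have "\<dots> = (\<Sum>j<c. \<Sum>k\<in>keys (h j). lookup (h j) k *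
        term_sum (\<lambda>l. e W (k + l)) (monomial (m j) + q j))"
      by (subst h(1)) (simp add: term_sum_sum term_sum_mult)
    also have "\<dots> = 0"
    proof (intro sum.neutral ballI)
      fix j k assume j: "j \<in> {..<c}" and k: "k \<in> keys (h j)"
      have "k + m j \<in> keys (h j * monomial (m j))"
        using k by (simp add: in_keys_iff lookup_mult_monomial)
      then have ge: "W \<le> mweight \<omega> k + mweight \<omega> (m j)"
        using h(2)[of j "k + m j"] j gt'_eq unfolding W_def by (auto simp: mweight_add)
      have keys_ge: "mweight \<omega> (m j) \<le> mweight \<omega> l" if "l \<in> keys (monomial (m j) + q j)" for l
      proof -
        have "l = m j \<or> l \<in> keys (q j)"
          using that keys_add[of "monomial (m j)" "q j"] by (auto simp: monomial_def)
        then show ?thesis using lower[of j l] j by auto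
      qed
      have "term_sum (\<lambda>l. e W (k + l)) (monomial (m j) + q j) = 0"
      \<comment> \<open>At equality only the lightest terms of the generator reach weight
        \<open>W\<close>, and \<open>zero\<close> applies; otherwise every term of the product is
        heavier than \<open>W\<close>.\<close>
      proof (cases "W = mweight \<omega> k + mweight \<omega> (m j)")
        case True
        then have "e W (k + l) = mono_eval z k * e (mweight \<omega> (m j)) l" for l
          by (auto simp: e_def mweight_add mono_eval_add)
        then have "term_sum (\<lambda>l. e W (k + l)) (monomial (m j) + q j) =
            mono_eval z k * term_sum (e (mweight \<omega> (m j))) (monomial (m j) + q j)"
          by (simp add: term_sum_def sum_distrib_left ac_simps)
        also have "term_sum (e (mweight \<omega> (m j))) (monomial (m j) + q j) = 0"
          using zero[of j] j unfolding e_def by simp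
        finally show ?thesis by simp
      next
        case False
        then have "e W (k + l) = 0" if "l \<in> keys (monomial (m j) + q j)" for l
          using keys_ge[OF that] ge by (simp add: e_def mweight_add)
        then show ?thesis by (simp add: term_sum_def)
      qed
      then show "lookup (h j) k * term_sum (\<lambda>l. e W (k + l)) (monomial (m j) + q j) = 0" by simp
    qed
    finally show ?thesis .
  qed
  assume "monomial a \<in> init_ideal \<omega> ?I"
  then have "poly_eval (monomial a) z = 0"
    unfolding init_ideal_def by (induction rule: ideal_gen_induct) (use eval in auto)
  then show False
    using z by (simp add: mono_eval_def)
qed

section \<open>Polyhedra\<close>

definition halfspaces :: "(real^'n) set \<Rightarrow> (real^'n) set" where
  "halfspaces A = {x. \<forall>a\<in>A. inner a x \<ge> -1}"

lemma convex_halfspaces: "convex (halfspaces A)"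
proof -
  have "halfspaces A = (\<Inter>a\<in>A. {x. inner a x \<ge> -1})" by (auto simp: halfspaces_def)
  then show ?thesis by (simp add: convex_INT convex_halfspace_ge)
qed

lemma closed_halfspaces: "closed (halfspaces A)"
proof -
  have "halfspaces A = (\<Inter>a\<in>A. {x. inner a x \<ge> -1})" by (auto simp: halfspaces_def)
  then show ?thesis by (simp add: closed_INT closed_halfspace_ge)
qed

text \<open>Strict inequalities tolerate a short step and there are finitely many of them, so only
  the tight ones restrict the direction \<open>d\<close>.\<close>

lemma halfspaces_perturb:
  assumes "finite A" "x \<in> halfspaces A" "\<And>a. a \<in> A \<Longrightarrow> inner a x = -1 \<Longrightarrow> inner a d \<ge> 0"
  obtains e where "e > 0" "x + e *\<^sub>R d \<in> halfspaces A"
proof -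
  have "\<exists>e>0. \<forall>a\<in>A. inner a (x + e *\<^sub>R d) \<ge> -1"
    using assms unfolding halfspaces_def
  proof (induction A rule: finite_induct)
    case empty
    then show ?case by (auto intro: exI[of _ 1])
  next
    case (insert a A)
    then obtain e where e: "e > 0" "\<forall>a\<in>A. inner a (x + e *\<^sub>R d) \<ge> -1" by auto
    have old: "inner b (x + e' *\<^sub>R d) \<ge> -1" if "b \<in> A" "0 \<le> e'" "e' \<le> e" for b e'
    proof -
      have "e * inner b d \<ge> - 1 - inner b x" "inner b x \<ge> -1"
        using e(2) that insert.prems by (auto simp: inner_add_right)
      moreover have "e' * inner b d \<ge> 0 \<or> e' * inner b d \<ge> e * inner b d"
        using that mult_right_mono_neg[of e' e "inner b d"] by (cases "inner b d \<ge> 0") auto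
      ultimately show ?thesis by (auto simp: inner_add_right)
    qed
    show ?case
    proof (cases "inner a d \<ge> 0")
      case True
      then have "inner a (x + e *\<^sub>R d) \<ge> -1"
        using insert.prems e(1) by (auto simp: inner_add_right add_increasing2)
      then show ?thesis using e by auto
    next
      case False
      then have "inner a x > -1" using insert.prems by force
      define e' where "e' = min e ((1 + inner a x) / (- inner a d))"
      have pos: "e' > 0" using e(1) False \<open>inner a x > -1\<close> by (simp add: e'_def divide_less_0_iff)
      have "e' \<le> (1 + inner a x) / (- inner a d)" by (simp add: e'_def)
      then have "e' * (- inner a d) \<le> 1 + inner a x" using False by (subst (asm) pos_le_divide_eq) auto
      then have "inner a (x + e' *\<^sub>R d) \<ge> -1" by (simp add: inner_add_right)
      moreover have "e' \<le> e" by (simp add: e'_def)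
      ultimately show ?thesis using pos old by (intro exI[of _ e']) auto
    qed
  qed
  then show thesis using that unfolding halfspaces_def by auto
qed

text \<open>The segment from \<open>x\<close> to \<open>x0\<close> extends beyond \<open>x0\<close>
  inside \<open>F\<close>; a value above the minimum at \<open>x\<close> would force one below it
  past \<open>x0\<close>.\<close>

lemma rel_interior_supporting:
  fixes F :: "(real^'n) set"
  assumes "convex F" "x0 \<in> rel_interior F" "\<And>x. x \<in> F \<Longrightarrow> inner a x \<ge> b" "inner a x0 = b" "x \<in> F"
  shows "inner a x = b"
proof -
  have "F \<noteq> {}" using assms(5) by auto
  then obtain e where e: "e > 1" "(1 - e) *\<^sub>R x + e *\<^sub>R x0 \<in> F"
    using convex_rel_interior_iff[OF assms(1)] assms(2,5) by blast
  then have "b \<le> inner a ((1 - e) *\<^sub>R x + e *\<^sub>R x0)" using assms(3) by blast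
  also have "\<dots> = (1 - e) * inner a x + e * b" using assms(4) by (simp add: inner_add_right)
  finally have "(e - 1) * inner a x \<le> (e - 1) * b" by (simp add: algebra_simps)
  then have "inner a x \<le> b" using e(1) by simp
  with assms(3,5) show ?thesis by (simp add: antisym)
qed

text \<open>If the constraints tight at \<open>x0\<close> are tight at \<open>x\<close>, a short
  step from \<open>x0\<close> away from \<open>x\<close> stays feasible. So \<open>x0\<close> lies
  inside a segment ending at \<open>x\<close>, and the face property yields
  \<open>x\<close>.\<close>

lemma face_of_halfspaces_eq:
  assumes "finite A" and F: "F face_of halfspaces A" and x0: "x0 \<in> rel_interior F"
  shows "F = {x \<in> halfspaces A. \<forall>a\<in>A. inner a x0 = -1 \<longrightarrow> inner a x = -1}" (is "F = ?R")
proof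
  have sub: "F \<subseteq> halfspaces A" using F by (rule face_of_imp_subset)
  have "x0 \<in> F" using x0 rel_interior_subset by blast
  show "F \<subseteq> ?R"
  proof
    fix x assume "x \<in> F"
    moreover have "inner a x = -1" if "a \<in> A" "inner a x0 = -1" for a
      using rel_interior_supporting[OF face_of_imp_convex[OF F] x0 _ that(2) \<open>x \<in> F\<close>] sub that(1)
      unfolding halfspaces_def by blast
    ultimately show "x \<in> ?R" using sub by blast
  qed
  show "?R \<subseteq> F"
  proof
    fix x assume x: "x \<in> ?R"
    show "x \<in> F"
    proof (cases "x = x0")
      case False
      obtain e where e: "e > 0" "x0 + e *\<^sub>R (x0 - x) \<in> halfspaces A"
        using halfspaces_perturb[OF assms(1), of x0 "x0 - x"] sub \<open>x0 \<in> F\<close> x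
        by (auto simp: inner_diff_right)
      let ?y = "x0 + e *\<^sub>R (x0 - x)"
      have "x0 = (1 - 1 / (1 + e)) *\<^sub>R x + (1 / (1 + e)) *\<^sub>R ?y"
      proof -
        have "(1 + e) *\<^sub>R x0 = e *\<^sub>R x + ?y" by (simp add: algebra_simps)
        then have "(1 / (1 + e)) *\<^sub>R ((1 + e) *\<^sub>R x0) = (1 / (1 + e)) *\<^sub>R (e *\<^sub>R x + ?y)" by simp
        moreover have "1 - 1 / (1 + e) = e / (1 + e)" using e(1) by (simp add: field_simps)
        ultimately show ?thesis using e(1) by (simp add: scaleR_add_right)
      qed
      moreover have "x \<noteq> ?y"
      proof
        assume "x = ?y"
        then have "(1 + e) *\<^sub>R (x0 - x) = 0" by (simp add: algebra_simps)
        then show False using False e(1) by simp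
      qed
      moreover have "0 < 1 / (1 + e)" "1 / (1 + e) < 1" using e(1) by simp_all
      ultimately have "x0 \<in> open_segment x ?y"
        unfolding in_segment by blast
      then show ?thesis using face_ofD[OF F] \<open>x0 \<in> F\<close> x e(2) by blast
    qed (use \<open>x0 \<in> F\<close> in simp)
  qed
qed

lemma face_of_halfspaces_tight:
  assumes "B \<subseteq> A"
  shows "{x \<in> halfspaces A. \<forall>a\<in>B. inner a x = -1} face_of halfspaces A"
proof (cases "B = {}")
  case True
  then show ?thesis by (simp add: face_of_refl convex_halfspaces)
next
  case False
  have "{x \<in> halfspaces A. \<forall>a\<in>B. inner a x = -1} = (\<Inter>a\<in>B. halfspaces A \<inter> {x. inner a x = -1})"
    using False by auto
  also have "\<dots> face_of halfspaces A"
  proof (rule face_of_Inter)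
    fix T assume "T \<in> (\<lambda>a. halfspaces A \<inter> {x. inner a x = -1}) ` B"
    then obtain a where a: "a \<in> A" "T = halfspaces A \<inter> {x. inner a x = -1}" using assms by blast
    show "T face_of halfspaces A"
      unfolding a(2)
    proof (rule face_of_Int_supporting_hyperplane_ge[OF convex_halfspaces])
      show "inner a x \<ge> -1" if "x \<in> halfspaces A" for x
        using that a(1) by (simp add: halfspaces_def)
    qed
  qed (use False in simp)
  finally show ?thesis .
qed

text \<open>A facet of a full-dimensional set spans a hyperplane, and a hyperplane determines its
  normal up to scaling.\<close>

lemma facet_normal_parallel:
  fixes P F :: "(real^'n) set"
  assumes P: "interior P \<noteq> {}" and F: "F facet_of P" and "r \<noteq> 0" "s \<noteq> 0"
    and r: "\<And>v. v \<in> F \<Longrightarrow> inner v r = \<alpha>" and s: "\<And>v. v \<in> F \<Longrightarrow> inner v s = \<beta>"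
  shows "\<exists>k. s = k *\<^sub>R r"
proof -
  have dim: "aff_dim F = int (DIM(real^'n)) - 1"
    using F aff_dim_nonempty_interior[OF P] unfolding facet_of_def by simp
  have ne: "F \<noteq> {}" using F by (simp add: facet_of_def)
  have hull: "affine hull F = {x. inner t x = \<gamma>}" if "t \<noteq> 0" "\<And>v. v \<in> F \<Longrightarrow> inner v t = \<gamma>" for t \<gamma>
  proof (rule affine_dim_equal)
    show "affine hull F \<subseteq> {x. inner t x = \<gamma>}"
      using that(2) by (intro hull_minimal affine_hyperplane) (simp add: subset_iff inner_commute)
  qed (use ne that(1) dim in \<open>auto simp: affine_hyperplane aff_dim_hyperplane\<close>)
  have hull_r: "affine hull F = {x. inner r x = \<alpha>}" and hull_s: "affine hull F = {x. inner s x = \<beta>}"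
    using hull[of r \<alpha>] hull[of s \<beta>] assms by blast+
  obtain v where v: "v \<in> F" using ne by blast
  define y where "y = s - (inner s r / inner r r) *\<^sub>R r"
  have "inner y r = 0" using \<open>r \<noteq> 0\<close> by (simp add: y_def inner_diff_left)
  then have "v + y \<in> affine hull F"
    unfolding hull_r using r[OF v] by (simp add: inner_add_right inner_commute)
  then have "inner y s = 0"
    unfolding hull_s using s[OF v] by (simp add: inner_add_right inner_commute)
  with \<open>inner y r = 0\<close> have "inner y y = 0" unfolding y_def by (simp add: inner_diff_right)
  then show ?thesis unfolding y_def by auto
qed

section \<open>Reflexive polytopes and their ray generators\<close>

lemma integral_inner:
  assumes "integral_vec u" "integral_vec v"
  shows "inner u v \<in> \<int>"
  using assms unfolding integral_vec_def inner_vec_def by (auto intro!: Ints_sum Ints_mult)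

lemma reflexive_convex: "reflexive P \<Longrightarrow> convex P" and reflexive_compact: "reflexive P \<Longrightarrow> compact P"
  unfolding reflexive_def lattice_polytope_def by (auto simp: finite_imp_compact_convex_hull)

text \<open>\<open>reflexive\<close> only provides an integral \<open>s\<close> with value
  \<open>-1\<close> on the facet. It is primitive because the facet contains an integral vertex: if
  \<open>s\<close> is \<open>k\<close> times an integral \<open>s'\<close>, the integer value of
  \<open>s'\<close> there is \<open>-1/k\<close>, so \<open>k \<le> 1\<close>.\<close>

lemma reflexive_facet_normal:
  assumes P: "reflexive P" and F: "F facet_of P"
  obtains s where "primitive_vec s" "s \<in> ray_generators P"
    "\<And>u. u \<in> P \<Longrightarrow> inner u s \<ge> -1" "\<And>u. u \<in> F \<Longrightarrow> inner u s = -1"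
proof -
  obtain s where s: "integral_vec s" "\<And>u. u \<in> P \<Longrightarrow> inner u s \<ge> -1" "\<And>u. u \<in> F \<Longrightarrow> inner u s = -1"
    using assms unfolding reflexive_def by meson
  have "F \<noteq> {}" "F face_of P" using F by (auto simp: facet_of_def)
  moreover have "compact F"
    using \<open>F face_of P\<close> reflexive_compact[OF P] reflexive_convex[OF P] face_of_imp_compact by blast
  ultimately obtain v where v: "v extreme_point_of F"
    using extreme_point_exists_convex face_of_imp_convex by blast
  then have "v \<in> F" "v extreme_point_of P"
    using extreme_point_of_face[OF \<open>F face_of P\<close>] by auto
  then have "integral_vec v"
    using P extreme_point_of_convex_hull unfolding reflexive_def lattice_polytope_def by blast
  have "primitive_vec s"
    unfolding primitive_vec_def
  proof (intro conjI allI impI)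
    show "s \<noteq> 0" using s(3)[OF \<open>v \<in> F\<close>] by auto
    fix s' :: "real^'a" and k :: real assume k: "integral_vec s' \<and> k > 0 \<and> s = k *\<^sub>R s'"
    then have eq: "k * inner v s' = -1" using s(3)[OF \<open>v \<in> F\<close>] by simp
    obtain i where i: "inner v s' = of_int i"
      using integral_inner[OF \<open>integral_vec v\<close>] k Ints_cases by blast
    have "inner v s' < 0" using eq k by (metis mult_nonneg_nonneg not_less less_imp_le neg_0_le_iff_le not_one_le_zero)
    then have "inner v s' \<le> -1" using i by simp
    then show "k \<le> 1" using eq k mult_left_mono[of "inner v s'" "-1" k] by simp
  qed (rule s(1))
  moreover have "s \<in> ray_generators P"
    unfolding ray_generators_def using calculation F s by force
  ultimately show thesis using that s by blast
qed

text \<open>\<open>ray_generators\<close> says only that \<open>r\<close> is primitive and minimal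
  on a facet. The normal from reflexivity is parallel to it, on the same side because the origin is
  interior, and two primitive vectors on one ray agree.\<close>

lemma reflexive_ray_generator:
  assumes P: "reflexive P" and r: "r \<in> ray_generators P" and u: "u \<in> P"
  shows "inner u r \<ge> -1"
proof -
  obtain F where F: "F facet_of P" and min: "\<And>u v. u \<in> P \<Longrightarrow> v \<in> F \<Longrightarrow> inner v r \<le> inner u r"
    and prim: "primitive_vec r"
    using r unfolding ray_generators_def by blast
  obtain s where s: "primitive_vec s" "\<And>u. u \<in> P \<Longrightarrow> inner u s \<ge> -1" "\<And>u. u \<in> F \<Longrightarrow> inner u s = -1"
    using reflexive_facet_normal[OF P F] by metis
  obtain v where v: "v \<in> F" using F by (auto simp: facet_of_def)
  have FP: "F \<subseteq> P" using F by (rule facet_of_imp_subset)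
  have int0: "0 \<in> interior P" using P by (simp add: reflexive_def)
  have ne: "r \<noteq> 0" "s \<noteq> 0" using prim s(1) by (auto simp: primitive_vec_def)
  have "inner v' r = inner v r" if "v' \<in> F" for v'
    using min v that FP by (meson antisym subsetD)
  then obtain k where k: "s = k *\<^sub>R r"
    using facet_normal_parallel[OF _ F ne _ s(3)] int0 by blast
  have "inner v r \<le> 0" using min[of 0 v] v int0 interior_subset by force
  moreover have "k * inner v r = -1" using s(3)[OF v] k by simp
  ultimately have "k > 0" by (metis mult_nonpos_nonpos neg_0_le_iff_le not_less not_one_le_zero)
  then have "k \<le> 1" using s(1) prim k unfolding primitive_vec_def by blast
  moreover have "r = (1 / k) *\<^sub>R s" using k \<open>k > 0\<close> by simp
  then have "1 / k \<le> 1" using s(1) prim \<open>k > 0\<close> unfolding primitive_vec_def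
    by (metis zero_less_divide_1_iff)
  ultimately have "k = 1" using \<open>k > 0\<close> by (simp add: field_simps)
  then show ?thesis using s(2)[OF u] k by simp
qed

text \<open>The segment from the origin to a point \<open>u\<close> outside \<open>P\<close> meets a
  facet at \<open>t *\<^sub>R u\<close> with \<open>t \<le> 1\<close>. The facet normal is
  \<open>-1\<close> there and at least \<open>-1\<close> at \<open>u\<close>, so
  \<open>t = 1\<close> and \<open>u\<close> was in \<open>P\<close> after all.\<close>

lemma reflexive_eq_halfspaces:
  assumes P: "reflexive P"
  shows "P = halfspaces (ray_generators P)"
proof
  show "P \<subseteq> halfspaces (ray_generators P)"
    using reflexive_ray_generator[OF P] unfolding halfspaces_def by (subst inner_commute) blast
  show "halfspaces (ray_generators P) \<subseteq> P"
  proof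
    fix u assume u: "u \<in> halfspaces (ray_generators P)"
    show "u \<in> P"
    proof (rule ccontr)
      assume "u \<notin> P"
      have poly: "polyhedron P"
        using P polytope_imp_polyhedron unfolding reflexive_def lattice_polytope_def polytope_def by blast
      have int0: "0 \<in> interior P" using P by (simp add: reflexive_def)
      then have rel: "rel_interior P = interior P" by (intro rel_interior_nonempty_interior) blast
      have "\<exists>x\<in>closed_segment 0 u. x \<in> frontier P"
        using connected_Int_frontier[of "closed_segment 0 u" P] int0 interior_subset \<open>u \<notin> P\<close> by force
      then obtain t where t: "0 \<le> t" "t \<le> 1" "t *\<^sub>R u \<in> frontier P" by (auto simp: in_segment)
      have "closed P" using reflexive_compact[OF P] by (rule compact_imp_closed)
      then have "t *\<^sub>R u \<in> P - rel_interior P" using t(3) rel by (simp add: frontier_def)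
      then obtain F where F: "F facet_of P" "t *\<^sub>R u \<in> F"
        unfolding rel_boundary_of_polyhedron[OF poly] by blast
      obtain s where s: "s \<in> ray_generators P" "\<And>u. u \<in> F \<Longrightarrow> inner u s = -1"
        using reflexive_facet_normal[OF P F(1)] by metis
      have "t * inner u s = -1" using s(2)[OF F(2)] by simp
      moreover have "inner u s \<ge> -1" using u s(1) by (auto simp: halfspaces_def inner_commute)
      ultimately have "t \<ge> 1"
        using t(1) mult_left_mono[of "-1" "inner u s" t] by simp
      then have "t = 1" using t(2) by simp
      then show False using F facet_of_imp_subset \<open>u \<notin> P\<close> by auto
    qed
  qed
qed

section \<open>Nef partitions\<close>

lemma minkowski_sum_iff:
  "x \<in> minkowski_sum A c \<longleftrightarrow> (\<exists>f. (\<forall>i<c. f i \<in> A i) \<and> x = (\<Sum>i<c. f i))"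
proof (induction c arbitrary: x)
  case (Suc c)
  show ?case
  proof
    assume "x \<in> minkowski_sum A (Suc c)"
    then obtain y z where yz: "y \<in> minkowski_sum A c" "z \<in> A c" "x = y + z"
      by (auto simp: set_plus_def)
    then obtain f where "\<forall>i<c. f i \<in> A i" "y = (\<Sum>i<c. f i)" using Suc.IH by blast
    then show "\<exists>f. (\<forall>i<Suc c. f i \<in> A i) \<and> x = (\<Sum>i<Suc c. f i)"
      using yz by (intro exI[of _ "f(c := z)"]) auto
  next
    assume "\<exists>f. (\<forall>i<Suc c. f i \<in> A i) \<and> x = (\<Sum>i<Suc c. f i)"
    then obtain f where f: "\<forall>i<Suc c. f i \<in> A i" "x = (\<Sum>i<c. f i) + f c" by auto
    then have "(\<Sum>i<c. f i) \<in> minkowski_sum A c" using Suc.IH by (metis less_Suc_eq)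
    then show "x \<in> minkowski_sum A (Suc c)" using f by (auto simp: set_plus_def)
  qed
qed simp

lemma minkowski_sum_mono:
  assumes "\<And>i. i < c \<Longrightarrow> A i \<subseteq> B i"
  shows "minkowski_sum A c \<subseteq> minkowski_sum B c"
  using assms unfolding subset_iff minkowski_sum_iff by blast

lemma convex_minkowski_sum:
  assumes "\<And>i. i < c \<Longrightarrow> convex (A i)"
  shows "convex (minkowski_sum A c)"
  using assms by (induction c) (auto intro: convex_set_plus)

locale nef_setting =
  fixes Delta :: "(real^'n) set" and rhat :: "'r::finite \<Rightarrow> real^'n" and c :: nat and J :: "nat \<Rightarrow> 'r set"
  assumes Delta_eq: "Delta = halfspaces (range rhat)"
    and Delta_bounded: "bounded Delta"
    and rhat_integral: "integral_vec (rhat r)"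
    and nef: "nef_partition Delta rhat c J"
begin

abbreviation D :: "nat \<Rightarrow> (real^'n) set" where "D \<equiv> Delta_part rhat J"

lemma Delta_iff: "u \<in> Delta \<longleftrightarrow> (\<forall>r. inner u (rhat r) \<ge> -1)"
  by (auto simp: Delta_eq halfspaces_def inner_commute)

lemma D_iff: "u \<in> D j \<longleftrightarrow> (\<forall>r. inner u (rhat r) \<ge> - Jind J j r)"
  by (simp add: Delta_part_def)

lemma D_subset_Delta: "D j \<subseteq> Delta"
proof
  fix u assume u: "u \<in> D j"
  have "- 1 \<le> - Jind J j r" for r by (simp add: Jind_def)
  with u show "u \<in> Delta" unfolding D_iff Delta_iff by (meson order_trans)
qed

lemma convex_Delta: "convex Delta" and compact_Delta: "compact Delta"
  using Delta_bounded by (auto simp: Delta_eq convex_halfspaces compact_eq_bounded_closed closed_halfspaces)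

lemma zero_Delta: "0 \<in> Delta"
  by (simp add: Delta_iff)

lemma Delta_perturb:
  assumes "x \<in> Delta" "\<And>r. inner x (rhat r) = -1 \<Longrightarrow> inner d (rhat r) \<ge> 0"
  obtains e where "e > 0" "x + e *\<^sub>R d \<in> Delta"
  using assms unfolding Delta_eq
  by (auto simp: inner_commute elim!: halfspaces_perturb[of "range rhat" x d, rotated])

text \<open>Completeness of the fan in dual form: a nonzero \<open>u\<close> could be scaled within
  \<open>Delta\<close> to norm \<open>b + 1\<close>, beyond the bound \<open>b\<close>.\<close>

lemma eq_0_if_nonneg:
  assumes "\<And>r. inner u (rhat r) \<ge> 0"
  shows "u = 0"
proof (rule ccontr)
  assume "u \<noteq> 0"
  obtain b where b: "b > 0" "\<And>x. x \<in> Delta \<Longrightarrow> norm x \<le> b" using Delta_bounded bounded_pos by blast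
  have "((b + 1) / norm u) *\<^sub>R u \<in> Delta"
    unfolding Delta_iff
  proof
    fix r
    have "0 \<le> (b + 1) / norm u * inner u (rhat r)" using assms b(1) by (intro mult_nonneg_nonneg) auto
    then show "-1 \<le> inner (((b + 1) / norm u) *\<^sub>R u) (rhat r)" by simp
  qed
  then have "norm (((b + 1) / norm u) *\<^sub>R u) \<le> b" by (rule b(2))
  then show False using \<open>u \<noteq> 0\<close> b(1) by simp
qed

lemma part_unique:
  assumes "i < c" "j < c" "r \<in> J i" "r \<in> J j"
  shows "i = j"
  using nef assms unfolding nef_partition_def by blast

text \<open>The divisors E_j add up to the anticanonical divisor.\<close>

lemma sum_Jind: "(\<Sum>j<c. Jind J j r) = 1"
proof -
  have "r \<in> (\<Union>j<c. J j)" using nef unfolding nef_partition_def by simp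
  then obtain j where j: "j < c" "r \<in> J j" by blast
  have "Jind J i r = (if i = j then 1 else 0)" if "i < c" for i
  proof (cases "i = j")
    case False
    then have "r \<notin> J i" using part_unique[OF that j(1) _ j(2)] by metis
    then show ?thesis using False by (simp add: Jind_def)
  qed (use j(2) in \<open>simp add: Jind_def\<close>)
  then have "(\<Sum>i<c. Jind J i r) = (\<Sum>i<c. if i = j then 1 else 0)" by (intro sum.cong) auto
  also have "\<dots> = 1" using j(1) by simp
  finally show ?thesis .
qed

lemma sum_D_in_Delta:
  assumes "\<And>j. j < c \<Longrightarrow> f j \<in> D j"
  shows "(\<Sum>j<c. f j) \<in> Delta"
  unfolding Delta_iff
proof
  fix r
  have "- 1 = (\<Sum>j<c. - Jind J j r)" using sum_Jind[of r] by (simp add: sum_negf)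
  also have "\<dots> \<le> (\<Sum>j<c. inner (f j) (rhat r))"
    using assms unfolding D_iff by (intro sum_mono) simp
  finally show "-1 \<le> inner (\<Sum>j<c. f j) (rhat r)" by (simp add: inner_sum_left)
qed

text \<open>A lexicographic minimum, first in direction \<open>w\<close>, then in direction
  \<open>w'\<close>: a face of the minimal face, which has a vertex. The second direction serves
  \<open>G_subset_polar\<close>.\<close>

lemma minimizing_vertex:
  obtains v where "v extreme_point_of Delta" "\<And>u. u \<in> Delta \<Longrightarrow> inner v w \<le> inner u w"
    "\<And>u. u \<in> Delta \<Longrightarrow> inner u w = inner v w \<Longrightarrow> inner v w' \<le> inner u w'"
proof -
  have min_face: "\<exists>\<alpha>. K \<inter> {x. inner t x = \<alpha>} \<noteq> {} \<and> K \<inter> {x. inner t x = \<alpha>} face_of K \<and>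
      compact (K \<inter> {x. inner t x = \<alpha>}) \<and> (\<forall>x\<in>K. inner t x \<ge> \<alpha>)"
    if K: "compact K" "convex K" "K \<noteq> {}" for K and t :: "real^'n"
  proof -
    obtain x where x: "x \<in> K" "\<And>y. y \<in> K \<Longrightarrow> inner t x \<le> inner t y"
      using continuous_attains_inf[OF K(1,3), of "\<lambda>x. inner t x"]
        continuous_on_inner[OF continuous_on_const continuous_on_id, of K t] by auto
    then have "K \<inter> {y. inner t y = inner t x} face_of K"
      by (intro face_of_Int_supporting_hyperplane_ge K(2)) auto
    moreover have "compact (K \<inter> {y. inner t y = inner t x})"
      by (intro compact_Int_closed K(1) closed_hyperplane)
    ultimately show ?thesis using x by blast
  qed
  obtain \<alpha> where K: "Delta \<inter> {x. inner w x = \<alpha>} \<noteq> {}" "Delta \<inter> {x. inner w x = \<alpha>} face_of Delta"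
      "compact (Delta \<inter> {x. inner w x = \<alpha>})" "\<forall>x\<in>Delta. inner w x \<ge> \<alpha>"
    using min_face[OF compact_Delta convex_Delta, of w] zero_Delta by blast
  let ?K = "Delta \<inter> {x. inner w x = \<alpha>}"
  obtain \<beta> where L: "?K \<inter> {x. inner w' x = \<beta>} \<noteq> {}" "?K \<inter> {x. inner w' x = \<beta>} face_of ?K"
      "compact (?K \<inter> {x. inner w' x = \<beta>})" "\<forall>x\<in>?K. inner w' x \<ge> \<beta>"
    using min_face[OF K(3) face_of_imp_convex[OF K(2)] K(1), of w'] by blast
  obtain v where v: "v extreme_point_of (?K \<inter> {x. inner w' x = \<beta>})"
    using extreme_point_exists_convex[OF L(3) face_of_imp_convex[OF L(2)] L(1)] by blast
  then have v': "v extreme_point_of Delta" "v \<in> ?K" "inner w' v = \<beta>"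
    using extreme_point_of_face[OF L(2)] extreme_point_of_face[OF K(2)] by auto
  show thesis
  proof (rule that[OF v'(1)])
    show "inner v w \<le> inner u w" if "u \<in> Delta" for u
      using K(4) that v'(2) by (simp add: inner_commute)
    show "inner v w' \<le> inner u w'" if "u \<in> Delta" "inner u w = inner v w" for u
      using L(4) that v'(2,3) by (simp add: inner_commute)
  qed
qed

section \<open>Cartier data and lattice minimizers\<close>

lemma cartier_data:
  assumes "v extreme_point_of Delta" "j < c"
  obtains m where "integral_vec m" "m \<in> D j" "\<And>r. inner v (rhat r) = -1 \<Longrightarrow> inner m (rhat r) = - Jind J j r"
  using nef assms unfolding nef_partition_def D_iff by meson

text \<open>The Cartier data of the E_j at \<open>v\<close> add up to that of the anticanonical
  divisor, which is \<open>v\<close> itself: a nonzero difference would be orthogonal to all rays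
  tight at \<open>v\<close>, so \<open>v\<close> could move both ways along it.\<close>

lemma cartier_sum:
  assumes v: "v extreme_point_of Delta"
    and m: "\<And>j r. j < c \<Longrightarrow> inner v (rhat r) = -1 \<Longrightarrow> inner (m j) (rhat r) = - Jind J j r"
  shows "v = (\<Sum>j<c. m j)"
proof (rule ccontr)
  assume "v \<noteq> (\<Sum>j<c. m j)"
  define d where "d = (\<Sum>j<c. m j) - v"
  have "d \<noteq> 0" using \<open>v \<noteq> _\<close> by (simp add: d_def)
  have vD: "v \<in> Delta" using v by (simp add: extreme_point_of_def)
  have tight: "inner d (rhat r) = 0" if "inner v (rhat r) = -1" for r
  proof -
    have "inner (\<Sum>j<c. m j) (rhat r) = (\<Sum>j<c. - Jind J j r)"
      using m that by (simp add: inner_sum_left)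
    then show ?thesis using sum_Jind[of r] that by (simp add: d_def inner_diff_left sum_negf)
  qed
  obtain e where e: "e > 0" "v + e *\<^sub>R d \<in> Delta" using Delta_perturb[OF vD, of d] tight by auto
  obtain e' where e': "e' > 0" "v + e' *\<^sub>R (- d) \<in> Delta"
    using Delta_perturb[OF vD, of "- d"] tight by auto
  have "v = (1 - e / (e + e')) *\<^sub>R (v + e *\<^sub>R d) + (e / (e + e')) *\<^sub>R (v + e' *\<^sub>R (- d))"
  proof -
    have "1 - e / (e + e') = e' / (e + e')" using e(1) e'(1) by (simp add: field_simps)
    moreover have "(e' / (e + e')) *\<^sub>R v + (e / (e + e')) *\<^sub>R v = v"
      using e(1) e'(1) by (simp add: scaleR_add_left[symmetric] add_divide_distrib[symmetric] add.commute)
    ultimately show ?thesis by (simp add: scaleR_add_right scaleR_diff_right mult.commute)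
  qed
  moreover have "v + e *\<^sub>R d \<noteq> v + e' *\<^sub>R (- d)"
  proof
    assume "v + e *\<^sub>R d = v + e' *\<^sub>R (- d)"
    then have "(e + e') *\<^sub>R d = 0" by (simp add: scaleR_add_left)
    then show False using \<open>d \<noteq> 0\<close> e(1) e'(1) by simp
  qed
  moreover have "0 < e / (e + e')" "e / (e + e') < 1" using e(1) e'(1) by auto
  ultimately have "v \<in> open_segment (v + e *\<^sub>R d) (v + e' *\<^sub>R (- d))"
    unfolding in_segment by blast
  then show False using v e(2) e'(2) unfolding extreme_point_of_def by blast
qed

text \<open>The Cartier datum \<open>m\<close> at the minimizing vertex \<open>v\<close> of
  \<open>Delta\<close> does it. For \<open>u\<close> in \<open>D j\<close>, a short step from
  \<open>v\<close> along \<open>u - m\<close> stays in \<open>Delta\<close>, because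
  \<open>m\<close> takes the least possible values on the rays tight at \<open>v\<close>; so
  minimality of \<open>v\<close> passes to \<open>m\<close>.\<close>

lemma minimizing_lattice_point:
  assumes "j < c"
  obtains m where "integral_vec m" "m \<in> D j" "\<And>u. u \<in> D j \<Longrightarrow> inner m w \<le> inner u w"
    "\<And>u. u \<in> D j \<Longrightarrow> inner u w = inner m w \<Longrightarrow> inner m w' \<le> inner u w'"
proof -
  obtain v where v: "v extreme_point_of Delta" "\<And>u. u \<in> Delta \<Longrightarrow> inner v w \<le> inner u w"
    "\<And>u. u \<in> Delta \<Longrightarrow> inner u w = inner v w \<Longrightarrow> inner v w' \<le> inner u w'"
    using minimizing_vertex[of w w'] by blast
  obtain m where m: "integral_vec m" "m \<in> D j"
    "\<And>r. inner v (rhat r) = -1 \<Longrightarrow> inner m (rhat r) = - Jind J j r"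
    using cartier_data[OF v(1) assms] by blast
  have step: "\<exists>e>0. v + e *\<^sub>R (u - m) \<in> Delta" if "u \<in> D j" for u
  proof (rule Delta_perturb[of v "u - m"])
    show "v \<in> Delta" using v(1) by (simp add: extreme_point_of_def)
    show "0 \<le> inner (u - m) (rhat r)" if "inner v (rhat r) = -1" for r
      using m(3)[OF that] \<open>u \<in> D j\<close> unfolding D_iff inner_diff_left by (metis diff_ge_0_iff_ge)
  qed blast
  show thesis
  proof (rule that[OF m(1,2)])
    fix u assume u: "u \<in> D j"
    obtain e where e: "e > 0" "v + e *\<^sub>R (u - m) \<in> Delta" using step[OF u] by blast
    have "0 \<le> e * (inner u w - inner m w)"
      using v(2)[OF e(2)] by (simp add: inner_add_left inner_diff_left)
    then show "inner m w \<le> inner u w" using e(1) by (simp add: zero_le_mult_iff)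
    assume "inner u w = inner m w"
    then have "0 \<le> e * (inner u w' - inner m w')"
      using v(3)[OF e(2)] by (simp add: inner_add_left inner_diff_left)
    then show "inner m w' \<le> inner u w'" using e(1) by (simp add: zero_le_mult_iff)
  qed
qed

subsection \<open>The lattice points of the perturbation\<close>

text \<open>\<open>Jind J j r + inner u (rhat r)\<close> is the exponent of x_r in the monomial of
  \<open>u\<close>. A vanishing exponent in every part says that no m_k divides it, so these are the
  lattice points of the monomials of g_j.\<close>

definition Xi :: "nat \<Rightarrow> (real^'n) set" where
  "Xi j = {u \<in> D j. integral_vec u \<and> (\<forall>k<c. \<exists>r\<in>J k. Jind J j r + inner u (rhat r) = 0)}"

definition Nab :: "(real^'n) set" where
  "Nab = halfspaces (\<Union>j<c. Xi j)"

text \<open>The combinatorial form of membership in the Bergman fan at height one; see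
  \<open>bergman_fan_imp_tight\<close> and \<open>tight_imp_bergman_fan\<close>.\<close>

definition tight :: "(real^'n) set" where
  "tight = {w \<in> Nab. \<forall>j<c. \<exists>u\<in>Xi j. inner u w = -1}"

lemma Nab_iff: "w \<in> Nab \<longleftrightarrow> (\<forall>j<c. \<forall>u\<in>Xi j. inner u w \<ge> -1)"
  by (auto simp: Nab_def halfspaces_def)

text \<open>Exclusion means that some m_k divides the monomial of \<open>u\<close>, so by
  integrality \<open>u\<close> has slack at least 1 on the rays of \<open>J k\<close>, enough to
  absorb \<open>x\<close>. The case \<open>k = j\<close> would make \<open>u\<close> nonnegative on
  all rays, hence zero.\<close>

lemma excluded_lattice_point:
  assumes u: "u \<in> D j" "integral_vec u" "u \<noteq> 0" "u \<notin> Xi j" and "j < c"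
  obtains k where "k < c" "\<And>x. x \<in> D k \<Longrightarrow> u + x \<in> D j"
proof -
  obtain k where k: "k < c" "\<And>r. r \<in> J k \<Longrightarrow> Jind J j r + inner u (rhat r) \<noteq> 0"
    using u(1,2,4) unfolding Xi_def by blast
  have ge1: "Jind J j r + inner u (rhat r) \<ge> 1" if "r \<in> J k" for r
  proof -
    have "Jind J j r + inner u (rhat r) \<in> \<int>"
      using integral_inner[OF u(2) rhat_integral, of r] by (auto simp: Jind_def)
    then obtain i where "Jind J j r + inner u (rhat r) = of_int i" using Ints_cases by blast
    moreover have "Jind J j r + inner u (rhat r) > 0"
      using u(1) k(2)[OF that] unfolding D_iff by (metis add.commute diff_0 diff_le_eq less_eq_real_def)
    ultimately show ?thesis by simp
  qed
  have "k \<noteq> j"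
  proof
    assume "k = j"
    have "inner u (rhat r) \<ge> 0" for r
    proof (cases "r \<in> J j")
      case True
      then show ?thesis using ge1[of r] \<open>k = j\<close> by (simp add: Jind_def)
    next
      case False
      have "inner u (rhat r) \<ge> - Jind J j r" using u(1) unfolding D_iff by blast
      then show ?thesis using False by (simp add: Jind_def)
    qed
    then show False using eq_0_if_nonneg u(3) by blast
  qed
  show thesis
  proof (rule that[OF k(1)])
    fix x assume x: "x \<in> D k"
    show "u + x \<in> D j"
      unfolding D_iff
    proof
      fix r
      have 1: "inner x (rhat r) \<ge> - Jind J k r" "inner u (rhat r) \<ge> - Jind J j r"
        using x u(1) unfolding D_iff by blast+
      show "- Jind J j r \<le> inner (u + x) (rhat r)"
      proof (cases "r \<in> J k")
        case True
        then show ?thesis using 1 ge1[OF True] by (simp add: Jind_def inner_add_left)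
      next
        case False
        then show ?thesis using 1 by (simp add: Jind_def[of J k] inner_add_left)
      qed
    qed
  qed
qed

text \<open>A minimizer excluded from \<open>Xi j\<close> because of the part \<open>k\<close> could be lowered further by
  adding a point of \<open>D k\<close> on which \<open>w\<close> is negative.\<close>

lemma tight_ge:
  assumes w: "w \<in> tight" and "j < c" and u: "u \<in> D j"
  shows "inner u w \<ge> -1"
proof -
  obtain m where m: "integral_vec m" "m \<in> D j" "\<And>u. u \<in> D j \<Longrightarrow> inner m w \<le> inner u w"
    using minimizing_lattice_point[OF \<open>j < c\<close>, of w w] by metis
  have Xi: "\<exists>u\<in>D k. inner u w = -1" if "k < c" for k
    using w that unfolding tight_def Xi_def by blast
  have "m \<in> Xi j"
  proof (rule ccontr)
    assume "m \<notin> Xi j"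
    have "m \<noteq> 0" using Xi[OF \<open>j < c\<close>] m(3) by force
    obtain k where k: "k < c" "\<And>x. x \<in> D k \<Longrightarrow> m + x \<in> D j"
      using excluded_lattice_point[OF m(2,1) \<open>m \<noteq> 0\<close> \<open>m \<notin> Xi j\<close> \<open>j < c\<close>] by blast
    obtain x where x: "x \<in> D k" "inner x w = -1" using Xi[OF k(1)] by blast
    have "inner m w \<le> inner (m + x) w" using m(3) k(2) x(1) by blast
    then show False using x(2) by (simp add: inner_add_left)
  qed
  then have "inner m w \<ge> -1" using w \<open>j < c\<close> unfolding tight_def Nab_iff by blast
  then show ?thesis using m(3)[OF u] by linarith
qed

text \<open>For \<open>w\<close> in \<open>tight\<close> the value \<open>-1\<close> is the minimum
  on \<open>D i\<close>, so this is the face of \<open>D i\<close> selected by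
  \<open>w\<close>.\<close>

definition G :: "(real^'n) \<Rightarrow> nat \<Rightarrow> (real^'n) set" where
  "G w i = {u \<in> D i. inner u w = -1}"

text \<open>For an excluded \<open>u\<close>, adding a point of \<open>G w k\<close> would give a
  point of \<open>D j\<close> with value \<open>-2\<close>.\<close>

lemma lattice_minimizer_Xi:
  assumes ge: "\<And>j u. j < c \<Longrightarrow> u \<in> D j \<Longrightarrow> inner u w \<ge> -1"
    and ne: "\<And>j. j < c \<Longrightarrow> G w j \<noteq> {}"
    and "j < c" and u: "u \<in> G w j" "integral_vec u"
  shows "u \<in> Xi j"
proof (rule ccontr)
  assume "u \<notin> Xi j"
  have u': "u \<in> D j" "inner u w = -1" using u(1) by (auto simp: G_def)
  then have "u \<noteq> 0" by auto
  obtain k where k: "k < c" "\<And>x. x \<in> D k \<Longrightarrow> u + x \<in> D j"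
    using excluded_lattice_point[OF u'(1) u(2) \<open>u \<noteq> 0\<close> \<open>u \<notin> Xi j\<close> \<open>j < c\<close>] by blast
  obtain x where x: "x \<in> D k" "inner x w = -1" using ne[OF k(1)] by (auto simp: G_def)
  have "inner (u + x) w \<ge> -1" using ge[OF \<open>j < c\<close>] k(2) x(1) by blast
  then show False using x(2) u'(2) by (simp add: inner_add_left)
qed

text \<open>Converse to \<open>tight_ge\<close> and \<open>tight_G_nonempty\<close>, phrased without
  \<open>Xi\<close>; it certifies the weight built in \<open>Phi_surjective\<close>.\<close>

lemma tightI:
  assumes ge: "\<And>j u. j < c \<Longrightarrow> u \<in> D j \<Longrightarrow> inner u w \<ge> -1"
    and ne: "\<And>j. j < c \<Longrightarrow> G w j \<noteq> {}"
  shows "w \<in> tight"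
proof -
  have "\<exists>u\<in>Xi j. inner u w = -1" if j: "j < c" for j
  proof -
    obtain m where m: "integral_vec m" "m \<in> D j" "\<And>u. u \<in> D j \<Longrightarrow> inner m w \<le> inner u w"
      using minimizing_lattice_point[OF j, of w w] by metis
    obtain u where "u \<in> D j" "inner u w = -1" using ne[OF j] by (auto simp: G_def)
    then have "inner m w = -1" using m(3)[of u] ge[OF j m(2)] by simp
    then show ?thesis using lattice_minimizer_Xi[OF ge ne j _ m(1)] m(2) by (auto simp: G_def)
  qed
  moreover have "w \<in> Nab" unfolding Nab_iff using ge by (auto simp: Xi_def)
  ultimately show ?thesis by (simp add: tight_def)
qed

lemma tight_G_nonempty: "w \<in> tight \<Longrightarrow> j < c \<Longrightarrow> G w j \<noteq> {}"
  by (fastforce simp: tight_def G_def Xi_def)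

lemma tight_G_selection:
  assumes "w \<in> tight"
  obtains f where "\<And>i. i < c \<Longrightarrow> f i \<in> G w i"
proof
  show "(SOME u. u \<in> G w i) \<in> G w i" if "i < c" for i
    using tight_G_nonempty[OF assms that] by (simp add: some_in_eq)
qed

lemma convex_G: "convex (G w i)"
proof -
  have "G w i = (\<Inter>r. {u. inner (rhat r) u \<ge> - Jind J i r}) \<inter> {u. inner w u = -1}"
    by (auto simp: G_def D_iff inner_commute)
  then show ?thesis
    by (simp add: convex_Int convex_INT convex_halfspace_ge convex_hyperplane)
qed

text \<open>Points of \<open>G w i\<close> need not be lattice points, so the inequalities defining
  \<open>Nab\<close> do not apply to them directly. They apply to a lattice point \<open>m\<close>
  minimizing \<open>w'\<close> among the minimizers of \<open>w\<close> on \<open>D i\<close>, and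
  \<open>u\<close> is one of these minimizers.\<close>

lemma G_subset_polar:
  assumes w: "w \<in> tight" and "i < c"
  shows "G w i \<subseteq> polar Nab"
  unfolding polar_def
proof (intro subsetI CollectI ballI)
  fix u w' assume u: "u \<in> G w i" and w': "w' \<in> Nab"
  obtain m where m: "integral_vec m" "m \<in> D i" "\<And>u. u \<in> D i \<Longrightarrow> inner m w \<le> inner u w"
    "\<And>u. u \<in> D i \<Longrightarrow> inner u w = inner m w \<Longrightarrow> inner m w' \<le> inner u w'"
    using minimizing_lattice_point[OF \<open>i < c\<close>, of w w'] by blast
  have u': "u \<in> D i" "inner u w = -1" using u by (auto simp: G_def)
  then have mw: "inner m w = -1" using m(3)[of u] tight_ge[OF w \<open>i < c\<close> m(2)] by simp
  then have "m \<in> Xi i"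
    using lattice_minimizer_Xi[OF tight_ge[OF w] tight_G_nonempty[OF w] \<open>i < c\<close> _ m(1)] m(2)
    by (auto simp: G_def)
  then have "inner m w' \<ge> -1" using w' \<open>i < c\<close> unfolding Nab_iff by blast
  then show "inner u w' \<ge> -1" using m(4)[of u] u' mw by simp
qed

section \<open>The face of \<open>Delta\<close> selected by a tight weight\<close>

definition min_face :: "(real^'n) \<Rightarrow> (real^'n) set" where
  "min_face w = {u \<in> Delta. inner u w = - real c}"

lemma sum_ge_eq:
  fixes a b :: "nat \<Rightarrow> real"
  assumes "\<And>i. i < c \<Longrightarrow> a i \<ge> b i" "(\<Sum>i<c. a i) = (\<Sum>i<c. b i)" "i < c"
  shows "a i = b i"
  using sum_nonneg_0[of "{..<c}" "\<lambda>i. a i - b i" i] assms by (simp add: sum_subtractf)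

text \<open>A minimizing vertex is a sum of Cartier data, one from each \<open>D j\<close>, and each
  contributes at least \<open>-1\<close>; hence the bound \<open>- real c\<close>.\<close>

lemma min_face_face_of:
  assumes w: "w \<in> tight"
  shows "min_face w face_of Delta" "u \<in> Delta \<Longrightarrow> inner u w \<ge> - real c"
proof -
  have ge: "inner u w \<ge> - real c" if "u \<in> Delta" for u
  proof -
    obtain v where v: "v extreme_point_of Delta" "\<And>u. u \<in> Delta \<Longrightarrow> inner v w \<le> inner u w"
      using minimizing_vertex[of w w] by metis
    have "\<exists>m. m \<in> D j \<and> (\<forall>r. inner v (rhat r) = -1 \<longrightarrow> inner m (rhat r) = - Jind J j r)" if "j < c" for j
      using cartier_data[OF v(1) that] by blast
    then obtain m where m: "\<And>j. j < c \<Longrightarrow> m j \<in> D j"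
      "\<And>j r. j < c \<Longrightarrow> inner v (rhat r) = -1 \<Longrightarrow> inner (m j) (rhat r) = - Jind J j r" by metis
    have "- real c = (\<Sum>j<c. - 1)" by simp
    also have "\<dots> \<le> (\<Sum>j<c. inner (m j) w)" using tight_ge[OF w] m(1) by (intro sum_mono) auto
    also have "\<dots> = inner v w" by (subst cartier_sum[OF v(1) m(2)]) (auto simp: inner_sum_left)
    also have "\<dots> \<le> inner u w" using v(2) that by blast
    finally show ?thesis .
  qed
  have "min_face w = Delta \<inter> {u. inner w u = - real c}" by (auto simp: min_face_def inner_commute)
  then show "min_face w face_of Delta"
    using face_of_Int_supporting_hyperplane_ge[OF convex_Delta, where a = w and b = "- real c"] ge
    by (simp add: inner_commute)
  show "u \<in> Delta \<Longrightarrow> inner u w \<ge> - real c" by (rule ge)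
qed

text \<open>A vertex of the minimal face splits into Cartier data with values at least
  \<open>-1\<close> and total \<open>- real c\<close>, so each value is \<open>-1\<close>. Convexity
  of the sum extends this from the vertices to the whole face.\<close>

lemma sum_G_eq_min_face:
  assumes w: "w \<in> tight"
  shows "minkowski_sum (G w) c = min_face w"
proof
  show "minkowski_sum (G w) c \<subseteq> min_face w"
  proof
    fix x assume "x \<in> minkowski_sum (G w) c"
    then obtain f where f: "\<forall>i<c. f i \<in> G w i" "x = (\<Sum>i<c. f i)" using minkowski_sum_iff by blast
    then have "x \<in> Delta" using sum_D_in_Delta[of f] by (auto simp: G_def)
    moreover have "inner x w = - real c" using f by (simp add: inner_sum_left G_def)
    ultimately show "x \<in> min_face w" by (simp add: min_face_def)
  qed
  have face: "min_face w face_of Delta" using min_face_face_of[OF w] by blast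
  then have "min_face w = convex hull {v. v extreme_point_of min_face w}"
    by (intro Krein_Milman_Minkowski face_of_imp_compact[OF convex_Delta compact_Delta] face_of_imp_convex)
  also have "\<dots> \<subseteq> minkowski_sum (G w) c"
  proof (rule hull_minimal)
    show "{v. v extreme_point_of min_face w} \<subseteq> minkowski_sum (G w) c"
    proof safe
      fix v assume "v extreme_point_of min_face w"
      then have v: "v extreme_point_of Delta" "v \<in> min_face w" using extreme_point_of_face[OF face] by auto
      have "\<exists>m. m \<in> D j \<and> (\<forall>r. inner v (rhat r) = -1 \<longrightarrow> inner m (rhat r) = - Jind J j r)" if "j < c" for j
        using cartier_data[OF v(1) that] by blast
      then obtain m where m: "\<And>j. j < c \<Longrightarrow> m j \<in> D j"
        "\<And>j r. j < c \<Longrightarrow> inner v (rhat r) = -1 \<Longrightarrow> inner (m j) (rhat r) = - Jind J j r" by metis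
      have sum: "v = (\<Sum>j<c. m j)" by (rule cartier_sum[OF v(1) m(2)])
      have "inner (m j) w = -1" if "j < c" for j
      proof (rule sum_ge_eq[OF _ _ that])
        show "(\<Sum>i<c. inner (m i) w) = (\<Sum>i<c. - 1)"
          using v(2) sum by (simp add: min_face_def inner_sum_left)
      qed (use tight_ge[OF w] m(1) in blast)
      then show "v \<in> minkowski_sum (G w) c"
        unfolding minkowski_sum_iff using m(1) sum by (auto simp: G_def)
    qed
  qed (rule convex_minkowski_sum[OF convex_G])
  finally show "min_face w \<subseteq> minkowski_sum (G w) c" .
qed

lemma min_face_nonempty:
  assumes "w \<in> tight"
  shows "min_face w \<noteq> {}"
proof -
  obtain f where "\<And>i. i < c \<Longrightarrow> f i \<in> G w i" using tight_G_selection[OF assms] by blast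
  then have "(\<Sum>i<c. f i) \<in> minkowski_sum (G w) c" unfolding minkowski_sum_iff by blast
  then show ?thesis unfolding sum_G_eq_min_face[OF assms] by blast
qed

text \<open>If no ray of the part \<open>j\<close> were orthogonal to the face, the \<open>j\<close>-th summand of a relative
  interior point could be stretched within \<open>Delta\<close>, lowering \<open>w\<close> below its minimum.\<close>

lemma min_face_strata:
  assumes w: "w \<in> tight"
  shows "min_face w \<in> strata Delta rhat c J"
proof -
  note face = min_face_face_of(1)[OF w]
  have "\<exists>r\<in>J j. \<forall>u\<in>min_face w. inner u (rhat r) = -1" if j: "j < c" for j
  proof (rule ccontr)
    assume *: "\<not> (\<exists>r\<in>J j. \<forall>u\<in>min_face w. inner u (rhat r) = -1)"
    have convex: "convex (min_face w)" using face by (rule face_of_imp_convex)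
    obtain x where x: "x \<in> rel_interior (min_face w)"
      using rel_interior_eq_empty[OF convex] min_face_nonempty[OF w] by blast
    then have xm: "x \<in> min_face w" using rel_interior_subset by blast
    then obtain f where f: "\<forall>i<c. f i \<in> G w i" "x = (\<Sum>i<c. f i)"
      unfolding sum_G_eq_min_face[OF w, symmetric] minkowski_sum_iff by blast
    have fj: "f j \<in> D j" "inner (f j) w = -1" using f(1) j by (auto simp: G_def)
    have "inner (f j) (rhat r) \<ge> 0" if r: "inner x (rhat r) = -1" for r
    proof -
      have "inner (rhat r) u = -1" if "u \<in> min_face w" for u
      proof (rule rel_interior_supporting[OF convex x _ _ that])
        show "-1 \<le> inner (rhat r) u" if "u \<in> min_face w" for u
          using that unfolding min_face_def Delta_iff by (simp add: inner_commute)
      qed (use r in \<open>simp add: inner_commute\<close>)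
      then have "r \<notin> J j" using * by (auto simp: inner_commute)
      moreover have "inner (f j) (rhat r) \<ge> - Jind J j r" using fj(1) unfolding D_iff by blast
      ultimately show ?thesis by (simp add: Jind_def)
    qed
    then obtain e where e: "e > 0" "x + e *\<^sub>R f j \<in> Delta"
      using Delta_perturb[of x "f j"] xm by (auto simp: min_face_def)
    have "inner (x + e *\<^sub>R f j) w = - real c - e" using xm fj(2) by (simp add: min_face_def inner_add_left)
    then show False using min_face_face_of(2)[OF w e(2)] e(1) by simp
  qed
  then show ?thesis using face min_face_nonempty[OF w] unfolding strata_def by blast
qed

text \<open>Put \<open>u\<close> into a sum of points of the \<open>G w k\<close>: on the ray the
  summands have lower bounds \<open>- Jind J k r\<close> adding up to \<open>-1\<close>, and the
  total is \<open>-1\<close>, so every bound is attained.\<close>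

lemma G_inner_ray:
  assumes w: "w \<in> tight" and r: "\<And>u. u \<in> min_face w \<Longrightarrow> inner u (rhat r) = -1"
    and "i < c" and u: "u \<in> G w i"
  shows "inner u (rhat r) = - Jind J i r"
proof -
  obtain f where f: "\<And>i. i < c \<Longrightarrow> f i \<in> G w i" using tight_G_selection[OF w] by blast
  define g where "g = f(i := u)"
  have g: "g k \<in> G w k" if "k < c" for k using f u that by (simp add: g_def)
  then have "(\<Sum>i<c. g i) \<in> min_face w"
    unfolding sum_G_eq_min_face[OF w, symmetric] minkowski_sum_iff by blast
  from r[OF this] have eq: "(\<Sum>i<c. inner (g i) (rhat r)) = (\<Sum>i<c. - Jind J i r)"
    using sum_Jind[of r] by (simp add: inner_sum_left sum_negf)
  have "inner (g i) (rhat r) = - Jind J i r"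
  proof (rule sum_ge_eq[where a = "\<lambda>k. inner (g k) (rhat r)" and b = "\<lambda>k. - Jind J k r", OF _ eq \<open>i < c\<close>])
    fix k assume "k < c"
    then have "g k \<in> D k" using g unfolding G_def by blast
    then show "- Jind J k r \<le> inner (g k) (rhat r)" unfolding D_iff by blast
  qed
  then show ?thesis by (simp add: g_def)
qed

subsection \<open>The duality between faces\<close>

lemma tight_subset_frontier:
  assumes w: "w \<in> tight" and "0 < c"
  shows "w \<in> frontier Nab"
proof -
  have wN: "w \<in> Nab" using w by (simp add: tight_def)
  obtain u where u: "u \<in> Xi 0" "inner u w = -1" using w \<open>0 < c\<close> by (auto simp: tight_def)
  have "w \<notin> interior Nab"
  proof
    assume "w \<in> interior Nab"
    then obtain e where e: "e > 0" "ball w e \<subseteq> Nab" using mem_interior by blast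
    have "u \<noteq> 0" using u(2) by auto
    define d where "d = e / (2 * norm u)"
    have d: "d > 0" using e(1) \<open>u \<noteq> 0\<close> by (simp add: d_def)
    have "w - d *\<^sub>R u \<in> ball w e"
      using \<open>u \<noteq> 0\<close> e(1) by (simp add: dist_norm d_def)
    then have "inner u (w - d *\<^sub>R u) \<ge> -1" using e(2) u(1) \<open>0 < c\<close> unfolding Nab_iff subset_iff by blast
    then have "d * inner u u \<le> 0" using u(2) by (simp add: inner_diff_right)
    moreover have "inner u u > 0" using \<open>u \<noteq> 0\<close> by simp
    ultimately show False using d by (simp add: mult_le_0_iff)
  qed
  then show ?thesis using wN closure_subset by (auto simp: frontier_def)
qed

text \<open>The equality \<open>-1\<close> on all of \<open>F\<close> needs checking only at
  \<open>x\<close>: each \<open>u\<close> in \<open>D i\<close> is at least \<open>-1\<close> on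
  \<open>F\<close>, and \<open>x\<close> is relatively interior.\<close>

lemma dual_face_part:
  assumes F: "F face_of Nab" "F \<subseteq> tight" and x: "x \<in> rel_interior F" and "i < c"
  shows "dual_face Nab F \<inter> D i = G x i"
proof
  have xF: "x \<in> F" using x rel_interior_subset by blast
  then show "dual_face Nab F \<inter> D i \<subseteq> G x i" by (auto simp: dual_face_def G_def)
  show "G x i \<subseteq> dual_face Nab F \<inter> D i"
  proof
    fix u assume u: "u \<in> G x i"
    have "inner u w = -1" if "w \<in> F" for w
    proof (rule rel_interior_supporting[OF face_of_imp_convex[OF F(1)] x _ _ that])
      show "inner u x = -1" using u by (simp add: G_def)
      fix w assume "w \<in> F"
      then have "w \<in> tight" using F(2) by blast
      then show "-1 \<le> inner u w" using tight_ge[OF _ \<open>i < c\<close>] u by (simp add: G_def)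
    qed
    moreover have "u \<in> polar Nab" using G_subset_polar[OF _ \<open>i < c\<close>] xF F(2) u by blast
    ultimately show "u \<in> dual_face Nab F \<inter> D i" using u by (simp add: dual_face_def G_def)
  qed
qed

definition Phi :: "(real^'n) set \<Rightarrow> (real^'n) set" where
  "Phi F = minkowski_sum (\<lambda>i. dual_face Nab F \<inter> D i) c"

lemma Phi_eq_min_face:
  assumes F: "F face_of Nab" "F \<subseteq> tight" and x: "x \<in> rel_interior F"
  shows "Phi F = min_face x"
proof -
  have "Phi F = minkowski_sum (G x) c"
    unfolding Phi_def
    by (intro equalityI minkowski_sum_mono) (use dual_face_part[OF F x] in auto)
  also have "\<dots> = min_face x"
    by (rule sum_G_eq_min_face) (use F(2) x rel_interior_subset in blast)
  finally show ?thesis .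
qed

lemma rel_interior_point_exists:
  assumes "F face_of Nab" "F \<noteq> {}"
  obtains x where "x \<in> rel_interior F" "x \<in> F"
  using rel_interior_eq_empty[OF face_of_imp_convex[OF assms(1)]] assms(2) rel_interior_subset by blast

lemma Phi_in_strata:
  assumes F: "F face_of Nab" "F \<subseteq> tight" "F \<noteq> {}"
  shows "Phi F \<in> strata Delta rhat c J"
proof -
  obtain x where x: "x \<in> rel_interior F" "x \<in> F" using rel_interior_point_exists F by blast
  then show ?thesis using Phi_eq_min_face[OF F(1,2) x(1)] min_face_strata[of x] F(2) by auto
qed

lemma Phi_antimono: "F \<subseteq> F' \<Longrightarrow> Phi F' \<subseteq> Phi F"
  unfolding Phi_def by (rule minkowski_sum_mono) (auto simp: dual_face_def)

text \<open>The summands can be recovered from the sum: put \<open>u\<close> into a sum of points of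
  the \<open>G x' k\<close>. It has value \<open>- real c\<close> at \<open>x\<close>, while each
  summand contributes at least \<open>-1\<close>.\<close>

lemma G_subset_if_min_face_subset:
  assumes "x \<in> tight" "x' \<in> tight" "min_face x' \<subseteq> min_face x" "i < c"
  shows "G x' i \<subseteq> G x i"
proof
  fix u assume u: "u \<in> G x' i"
  obtain f where f: "\<And>i. i < c \<Longrightarrow> f i \<in> G x' i" using tight_G_selection[OF assms(2)] by blast
  define g where "g = f(i := u)"
  have g: "g k \<in> G x' k" if "k < c" for k using f[OF that] u by (simp add: g_def)
  then have "(\<Sum>i<c. g i) \<in> minkowski_sum (G x') c" unfolding minkowski_sum_iff by blast
  then have "(\<Sum>i<c. g i) \<in> min_face x" using sum_G_eq_min_face[OF assms(2)] assms(3) by blast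
  then have eq: "(\<Sum>i<c. inner (g i) x) = (\<Sum>i<c. - 1)" by (simp add: min_face_def inner_sum_left)
  have "inner (g i) x = -1"
  proof (rule sum_ge_eq[where a = "\<lambda>k. inner (g k) x" and b = "\<lambda>_. - 1", OF _ eq assms(4)])
    show "-1 \<le> inner (g k) x" if "k < c" for k
      using tight_ge[OF assms(1) that] g[OF that] by (simp add: G_def)
  qed
  then show "u \<in> G x i" using u by (simp add: g_def G_def)
qed

subsection \<open>Lattice points as monomials\<close>

definition exponent :: "nat \<Rightarrow> 'r option mono \<Rightarrow> (real^'n) \<Rightarrow> bool" where
  "exponent j a u \<longleftrightarrow> None \<notin> keys a \<and> (\<forall>r. real (lookup a (Some r)) = Jind J j r + inner u (rhat r))"

abbreviation "monos \<equiv> g_monos rhat c J"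

lemma g_monos_exponent:
  assumes "a \<in> monos j"
  obtains u where "u \<in> Xi j" "exponent j a u"
proof -
  obtain u where u: "integral_vec u" "\<And>r. real (lookup a (Some r)) - Jind J j r = inner u (rhat r)"
    and a: "None \<notin> keys a" "\<not> in_I0 c J a"
    using assms unfolding g_monos_def by blast
  have eq: "real (lookup a (Some r)) = Jind J j r + inner u (rhat r)" for r
    using u(2)[of r] by linarith
  have "u \<in> D j"
    unfolding D_iff
  proof
    show "- Jind J j r \<le> inner u (rhat r)" for r
      using eq[of r] of_nat_0_le_iff[of "lookup a (Some r)", where 'a = real] by linarith
  qed
  moreover have "\<exists>r\<in>J k. Jind J j r + inner u (rhat r) = 0" if k: "k < c" for k
  proof -
    obtain r where "r \<in> J k" "\<not> lookup a (Some r) \<ge> 1" using a(2) k unfolding in_I0_def by blast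
    then show ?thesis using eq[of r] by (intro bexI[of _ r]) auto
  qed
  ultimately show thesis using that[of u] u(1) eq a(1) by (auto simp: Xi_def exponent_def)
qed

lemma Xi_exponent:
  assumes u: "u \<in> Xi j"
  obtains a where "a \<in> monos j" "exponent j a u"
proof -
  have uD: "u \<in> D j" "integral_vec u" using u by (auto simp: Xi_def)
  define e where "e r = Jind J j r + inner u (rhat r)" for r
  define f where "f v = (case v of None \<Rightarrow> 0 | Some r \<Rightarrow> nat \<lfloor>e r\<rfloor>)" for v
  define a where "a = Abs_poly_mapping f"
  have la: "lookup a = f" unfolding a_def by simp
  have e: "real (nat \<lfloor>e r\<rfloor>) = e r" for r
  proof -
    have "e r \<in> \<int>" unfolding e_def using integral_inner[OF uD(2) rhat_integral] by (auto simp: Jind_def)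
    then obtain i where i: "e r = of_int i" using Ints_cases by blast
    have "- Jind J j r \<le> inner u (rhat r)" using uD(1) unfolding D_iff by blast
    then have "e r \<ge> 0" by (simp add: e_def)
    then show ?thesis using i by simp
  qed
  have ex: "exponent j a u"
    unfolding exponent_def using e by (auto simp: la f_def in_keys_iff e_def)
  moreover have "\<not> in_I0 c J a"
    unfolding in_I0_def
  proof safe
    fix k assume k: "k < c" "\<forall>r\<in>J k. lookup a (Some r) \<ge> 1"
    obtain r where r: "r \<in> J k" "e r = 0" using u k(1) unfolding Xi_def e_def by blast
    then show False using k(2) by (auto simp: la f_def)
  qed
  ultimately have "a \<in> monos j"
    unfolding g_monos_def exponent_def using uD(2) by (auto intro!: exI[of _ u])
  with ex show thesis by (rule that[rotated])
qed

lemma exponent_unique: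
  assumes "exponent j a u" "exponent j a u'"
  shows "u = u'"
proof -
  have "inner (u - u') (rhat r) = 0" for r
  proof -
    have "real (lookup a (Some r)) = Jind J j r + inner u (rhat r)"
      "real (lookup a (Some r)) = Jind J j r + inner u' (rhat r)"
      using assms unfolding exponent_def by blast+
    then show ?thesis by (simp add: inner_diff_left)
  qed
  then have "u - u' = 0" by (intro eq_0_if_nonneg) simp
  then show ?thesis by simp
qed

text \<open>Over an infinite set the sum defining \<open>g_poly\<close> would be 0 by convention.
  Boundedness of \<open>Delta\<close> bounds all exponents.\<close>

lemma finite_g_monos: "finite (monos j)"
proof -
  obtain b where b: "b > 0" "\<And>x. x \<in> Delta \<Longrightarrow> norm x \<le> b" using Delta_bounded bounded_pos by blast
  define N where "N = nat \<lceil>1 + b * (\<Sum>r\<in>UNIV. norm (rhat r))\<rceil>"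
  have "lookup a v \<le> N" if a: "a \<in> monos j" for a v
  proof (cases v)
    case None
    then show ?thesis using a by (simp add: g_monos_def not_in_keys_iff_lookup_eq_zero)
  next
    case (Some r)
    obtain u where u: "u \<in> Xi j" "exponent j a u" using g_monos_exponent[OF a] by blast
    have "norm u \<le> b" using u(1) b(2) D_subset_Delta by (auto simp: Xi_def)
    have "inner u (rhat r) \<le> norm u * norm (rhat r)" by (rule norm_cauchy_schwarz)
    also have "\<dots> \<le> b * (\<Sum>r\<in>UNIV. norm (rhat r))"
      using \<open>norm u \<le> b\<close> b(1) member_le_sum[of r UNIV "\<lambda>r. norm (rhat r)"] by (intro mult_mono) auto
    finally have "inner u (rhat r) \<le> b * (\<Sum>r\<in>UNIV. norm (rhat r))" .
    moreover have "Jind J j r \<le> 1" by (simp add: Jind_def)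
    moreover have "real (lookup a (Some r)) = Jind J j r + inner u (rhat r)"
      using u(2) unfolding exponent_def by blast
    ultimately have "real (lookup a (Some r)) \<le> 1 + b * (\<Sum>r\<in>UNIV. norm (rhat r))" by linarith
    then show ?thesis unfolding N_def Some by linarith
  qed
  then show ?thesis by (intro finite_subset[OF _ finite_bounded_monos[of N]]) auto
qed

lemma finite_Xi: "finite (Xi j)"
proof (rule finite_surj[OF finite_g_monos[of j]])
  show "Xi j \<subseteq> (\<lambda>a. THE u. exponent j a u) ` monos j"
  proof
    fix u assume "u \<in> Xi j"
    then obtain a where a: "a \<in> monos j" "exponent j a u" using Xi_exponent by blast
    then have "(THE u. exponent j a u) = u" using exponent_unique by blast
    then show "u \<in> (\<lambda>a. THE u. exponent j a u) ` monos j" using a(1) by force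
  qed
qed

text \<open>\<open>F'\<close> is cut out by the points of the \<open>Xi j\<close> tight at
  \<open>x'\<close>. These lie in \<open>G x' j\<close>, hence in \<open>G x j\<close>, so they are
  tight at \<open>x\<close> and therefore on all of \<open>F\<close>.\<close>

lemma Phi_order_reflecting:
  assumes F: "F face_of Nab" "F \<subseteq> tight" "F \<noteq> {}" and F': "F' face_of Nab" "F' \<subseteq> tight" "F' \<noteq> {}"
    and sub: "Phi F' \<subseteq> Phi F"
  shows "F \<subseteq> F'"
proof
  fix w assume w: "w \<in> F"
  have fin: "finite (\<Union>j<c. Xi j)" using finite_Xi by blast
  obtain x where x: "x \<in> rel_interior F" "x \<in> F" using rel_interior_point_exists F by blast
  obtain x' where x': "x' \<in> rel_interior F'" "x' \<in> F'" using rel_interior_point_exists F' by blast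
  have xt: "x \<in> tight" "x' \<in> tight" using x x' F(2) F'(2) by auto
  have mf: "min_face x' \<subseteq> min_face x"
    using sub Phi_eq_min_face[OF F(1,2) x(1)] Phi_eq_min_face[OF F'(1,2) x'(1)] by simp
  have "inner a w = -1" if a: "j < c" "a \<in> Xi j" "inner a x' = -1" for a j
  proof -
    have "a \<in> G x' j" using a by (simp add: G_def Xi_def)
    then have "inner a x = -1" using G_subset_if_min_face_subset[OF xt mf a(1)] by (auto simp: G_def)
    then show ?thesis
      using face_of_halfspaces_eq[OF fin F(1)[unfolded Nab_def] x(1)] w a(1,2) by blast
  qed
  moreover have "w \<in> Nab" using w F(2) by (auto simp: tight_def)
  ultimately show "w \<in> F'"
    unfolding face_of_halfspaces_eq[OF fin F'(1)[unfolded Nab_def] x'(1)] Nab_def by blast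
qed

lemma Phi_surjective:
  assumes "H \<in> strata Delta rhat c J"
  obtains F where "F face_of Nab" "F \<subseteq> tight" "F \<noteq> {}" "Phi F = H"
proof -
  have H: "H face_of Delta" "H \<noteq> {}" "\<And>j. j < c \<Longrightarrow> \<exists>r\<in>J j. \<forall>u\<in>H. inner u (rhat r) = -1"
    using assms unfolding strata_def by auto
  define R where "R = {r. \<forall>u\<in>H. inner u (rhat r) = -1}"
  define k where "k j = real (card (R \<inter> J j))" for j
  \<comment> \<open>Dividing by \<open>k j\<close> gives every part total weight 1. On
    \<open>D i\<close> only the rays of \<open>J i\<close> have a negative lower bound, so
    \<open>w0\<close> is at least \<open>-1\<close> there.\<close>
  define w0 where "w0 = (\<Sum>j<c. \<Sum>r\<in>R \<inter> J j. (1 / k j) *\<^sub>R rhat r)"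
  have w0: "inner u w0 = (\<Sum>j<c. \<Sum>r\<in>R \<inter> J j. inner u (rhat r) / k j)" for u
    by (simp add: w0_def inner_sum_right)
  have k: "k j > 0" if "j < c" for j
  proof -
    have "R \<inter> J j \<noteq> {}" using H(3)[OF that] by (auto simp: R_def)
    then show ?thesis by (simp add: k_def card_gt_0_iff)
  qed
  have const: "(\<Sum>r\<in>R \<inter> J j. x / k j) = x" if "j < c" for j and x :: real
    using k[OF that] by (cases "R \<inter> J j = {}") (simp_all add: k_def)
  have Jind_part: "Jind J i r = (if i = j then 1 else 0)" if "i < c" "j < c" "r \<in> J j" for i j r
  proof (cases "i = j")
    case False
    then have "r \<notin> J i" using part_unique[OF that(1,2) _ that(3)] by metis
    then show ?thesis using False by (simp add: Jind_def)
  qed (use that(3) in \<open>simp add: Jind_def\<close>)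
  have sum_part: "(\<Sum>j<c. \<Sum>r\<in>R \<inter> J j. - Jind J i r / k j) = -1" if i: "i < c" for i
  proof -
    have "(\<Sum>r\<in>R \<inter> J j. - Jind J i r / k j) = (if i = j then - 1 else 0)" if "j < c" for j
    proof -
      have "(\<Sum>r\<in>R \<inter> J j. - Jind J i r / k j) = (\<Sum>r\<in>R \<inter> J j. (if i = j then - 1 else 0) / k j)"
        using Jind_part[OF i that] by (intro sum.cong) auto
      also have "\<dots> = (if i = j then - 1 else 0)" by (rule const[OF that])
      finally show ?thesis .
    qed
    then have "(\<Sum>j<c. \<Sum>r\<in>R \<inter> J j. - Jind J i r / k j) = (\<Sum>j<c. if i = j then - 1 else 0)"
      by (intro sum.cong) auto
    also have "\<dots> = -1" using i by simp
    finally show ?thesis .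
  qed
  have ge: "inner u w0 \<ge> -1" if i: "i < c" and u: "u \<in> D i" for i u
  proof -
    have "(\<Sum>j<c. \<Sum>r\<in>R \<inter> J j. - Jind J i r / k j) \<le> inner u w0"
      unfolding w0 using u k unfolding D_iff
      by (intro sum_mono divide_right_mono) (auto intro: less_imp_le)
    then show ?thesis using sum_part[OF i] by simp
  qed
  obtain v where v: "v extreme_point_of H"
    using extreme_point_exists_convex[OF face_of_imp_compact[OF convex_Delta compact_Delta H(1)]
        face_of_imp_convex[OF H(1)] H(2)] by blast
  then have v': "v extreme_point_of Delta" "v \<in> H" using extreme_point_of_face[OF H(1)] by auto
  have ne: "G w0 i \<noteq> {}" if i: "i < c" for i
  proof -
    obtain m where m: "m \<in> D i" "\<And>r. inner v (rhat r) = -1 \<Longrightarrow> inner m (rhat r) = - Jind J i r"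
      using cartier_data[OF v'(1) i] by blast
    have "inner m (rhat r) = - Jind J i r" if "r \<in> R" for r using m(2) that v'(2) by (simp add: R_def)
    then have "inner m w0 = (\<Sum>j<c. \<Sum>r\<in>R \<inter> J j. - Jind J i r / k j)"
      unfolding w0 by (intro sum.cong) auto
    then have "m \<in> G w0 i" using m(1) sum_part[OF i] by (simp add: G_def)
    then show ?thesis by blast
  qed
  have t0: "w0 \<in> tight" by (rule tightI[OF ge ne])
  \<comment> \<open>\<open>H\<close> is recovered from \<open>R\<close> because the rays tight at a
    relative interior point of \<open>H\<close> are tight on all of it.\<close>
  have H_eq: "H = {u \<in> Delta. \<forall>r\<in>R. inner u (rhat r) = -1}"
  proof -
    obtain x where x: "x \<in> rel_interior H"
      using rel_interior_eq_empty[OF face_of_imp_convex[OF H(1)]] H(2) by blast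
    have "r \<in> R" if "inner (rhat r) x = -1" for r
    proof -
      have "inner (rhat r) u = -1" if "u \<in> H" for u
      proof (rule rel_interior_supporting[OF face_of_imp_convex[OF H(1)] x _ \<open>inner (rhat r) x = -1\<close> that])
        show "-1 \<le> inner (rhat r) u" if "u \<in> H" for u
          using that face_of_imp_subset[OF H(1)] unfolding subset_iff Delta_iff by (simp add: inner_commute)
      qed
      then show ?thesis by (simp add: R_def inner_commute)
    qed
    then have "{u \<in> Delta. \<forall>r\<in>R. inner u (rhat r) = -1} \<subseteq> H"
      using face_of_halfspaces_eq[of "range rhat" H x] H(1) x unfolding Delta_eq
      by (auto simp: inner_commute)
    moreover have "H \<subseteq> {u \<in> Delta. \<forall>r\<in>R. inner u (rhat r) = -1}"
      using face_of_imp_subset[OF H(1)] by (auto simp: R_def)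
    ultimately show ?thesis by blast
  qed
  have cover: "\<exists>j<c. r \<in> J j" for r
  proof -
    have "r \<in> (\<Union>j<c. J j)" using nef unfolding nef_partition_def by simp
    then show ?thesis by blast
  qed
  have mf: "min_face w0 = H"
  proof
    show "H \<subseteq> min_face w0"
    proof
      fix u assume u: "u \<in> H"
      have "inner u w0 = (\<Sum>j<c. \<Sum>r\<in>R \<inter> J j. - 1 / k j)"
        unfolding w0 using u by (intro sum.cong) (auto simp: R_def)
      also have "\<dots> = (\<Sum>j<c. - 1)" by (intro sum.cong const) auto
      finally show "u \<in> min_face w0"
        using u face_of_imp_subset[OF H(1)] by (auto simp: min_face_def)
    qed
    show "min_face w0 \<subseteq> H"
    proof
      fix u assume "u \<in> min_face w0"
      then have u: "u \<in> Delta" "inner u w0 = - real c" by (auto simp: min_face_def)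
      \<comment> \<open>The summands are nonnegative and their total is \<open>c - c = 0\<close>, so
        every ray of \<open>R\<close> is tight at \<open>u\<close>.\<close>
      have "(\<Sum>j<c. \<Sum>r\<in>R \<inter> J j. (inner u (rhat r) + 1) / k j) =
          inner u w0 + (\<Sum>j<c. \<Sum>r\<in>R \<inter> J j. 1 / k j)"
        unfolding w0 by (simp add: add_divide_distrib sum.distrib)
      also have "(\<Sum>j<c. \<Sum>r\<in>R \<inter> J j. 1 / k j) = (\<Sum>j<c. 1)" by (intro sum.cong const) auto
      finally have zero: "(\<Sum>j<c. \<Sum>r\<in>R \<inter> J j. (inner u (rhat r) + 1) / k j) = 0" using u(2) by simp
      have nn: "(inner u (rhat r) + 1) / k j \<ge> 0" if "j < c" for j r
      proof -
        have "inner u (rhat r) \<ge> -1" using u(1) unfolding Delta_iff by blast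
        then show ?thesis using k[OF that] by simp
      qed
      have "inner u (rhat r) = -1" if r: "r \<in> R" for r
      proof -
        obtain j where j: "j < c" "r \<in> J j" using cover by blast
        have "(\<Sum>r\<in>R \<inter> J j. (inner u (rhat r) + 1) / k j) = 0"
          by (rule sum_nonneg_0[OF _ _ zero]) (auto intro!: sum_nonneg nn j(1))
        then have "(inner u (rhat r) + 1) / k j = 0"
          by (rule sum_nonneg_0[rotated 2]) (auto intro!: nn j r)
        then show ?thesis using k[OF j(1)] by simp
      qed
      then show "u \<in> H" unfolding H_eq using u(1) by blast
    qed
  qed
  define A where "A = (\<Union>j<c. Xi j)"
  have fin: "finite A" using finite_Xi by (simp add: A_def)
  have Nab_A: "Nab = halfspaces A" by (simp add: Nab_def A_def)
  define F where "F = {w \<in> Nab. \<forall>a\<in>{a \<in> A. inner a w0 = -1}. inner a w = -1}"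
  have face: "F face_of Nab"
    unfolding F_def Nab_A by (rule face_of_halfspaces_tight) blast
  have "w0 \<in> F" using t0 by (auto simp: F_def tight_def)
  have Ft: "F \<subseteq> tight"
  proof
    fix w assume w: "w \<in> F"
    have "\<exists>u\<in>Xi j. inner u w = -1" if "j < c" for j
    proof -
      obtain u where "u \<in> Xi j" "inner u w0 = -1" using t0 \<open>j < c\<close> unfolding tight_def by blast
      then show ?thesis using w \<open>j < c\<close> unfolding F_def A_def by blast
    qed
    then show "w \<in> tight" using w by (simp add: tight_def F_def)
  qed
  have "w0 \<in> rel_interior F"
  proof -
    have "\<exists>e>1. (1 - e) *\<^sub>R x + e *\<^sub>R w0 \<in> F" if x: "x \<in> F" for x
    proof -
      obtain e where e: "e > 0" "w0 + e *\<^sub>R (w0 - x) \<in> halfspaces A"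
        using halfspaces_perturb[OF fin, of w0 "w0 - x"] \<open>w0 \<in> F\<close> x
        by (auto simp: F_def Nab_A inner_diff_right)
      have "w0 + e *\<^sub>R (w0 - x) \<in> F"
        using e(2) x by (auto simp: F_def Nab_A inner_add_right inner_diff_right)
      moreover have "(1 - (1 + e)) *\<^sub>R x + (1 + e) *\<^sub>R w0 = w0 + e *\<^sub>R (w0 - x)"
        by (simp add: algebra_simps)
      ultimately show ?thesis using e(1) by (intro exI[of _ "1 + e"]) auto
    qed
    then show ?thesis
      using convex_rel_interior_iff[OF face_of_imp_convex[OF face]] \<open>w0 \<in> F\<close> by blast
  qed
  then have "Phi F = H" using Phi_eq_min_face[OF face Ft] mf by simp
  then show thesis using that face Ft \<open>w0 \<in> F\<close> by blast
qed

subsection \<open>Weights of the generators\<close>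

definition mJ :: "nat \<Rightarrow> 'r option mono" where
  "mJ j = (\<Sum>r\<in>J j. single (Some r) 1)"

definition tq :: "(nat \<times> 'r option mono \<Rightarrow> complex) \<Rightarrow> nat \<Rightarrow> 'r option mpoly" where
  "tq coef j = (\<Sum>a\<in>monos j. single (single None 1 + a) (coef (j, a)))"

lemma lookup_mJ [simp]: "lookup (mJ j) None = 0" "lookup (mJ j) (Some r) = (if r \<in> J j then 1 else 0)"
  by (simp_all add: mJ_def lookup_sum lookup_single when_def)

lemma generator_eq: "var None * g_poly rhat c J coef j + m_gen J j = monomial (mJ j) + tq coef j"
  by (simp add: m_gen_def mJ_def tq_def g_poly_def var_def monomial_def sum_distrib_left mult_single)

lemma I_fam_eq: "I_fam rhat c J coef = ideal_gen {monomial (mJ j) + tq coef j | j. j < c}"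
  by (simp add: I_fam_def generator_eq)

lemma I0_ext_eq: "I0_ext c J = ideal_gen {monomial (mJ j) | j. j < c}"
  by (simp add: I0_ext_def m_gen_def mJ_def)

lemma mJ_coprime:
  assumes "i < c" "j < c" "i \<noteq> j"
  shows "lookup (mJ i) v = 0 \<or> lookup (mJ j) v = 0"
  using part_unique[OF assms(1,2)] assms(3) by (cases v) auto

lemma keys_tq:
  assumes "b \<in> keys (tq coef j)"
  obtains a where "a \<in> monos j" "b = single None 1 + a"
proof -
  have "b \<in> (\<Union>a\<in>monos j. keys (single (single None 1 + a) (coef (j, a))))"
    using assms keys_sum[of "\<lambda>a. single (single None 1 + a) (coef (j, a))" "monos j"]
    unfolding tq_def by blast
  then show thesis using that by (auto split: if_splits)
qed

lemma lookup_tq: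
  assumes "a \<in> monos j"
  shows "lookup (tq coef j) (single None 1 + a) = coef (j, a)"
  using assms finite_g_monos[of j] by (simp add: tq_def lookup_sum lookup_single when_def)

lemma lookup_None_t_mult:
  assumes "a \<in> monos j"
  shows "lookup (single None 1 + a) None = 1"
  using assms by (simp add: lookup_add g_monos_def not_in_keys_iff_lookup_eq_zero)

lemma mJ_notin_keys_tq: "mJ j \<notin> keys (tq coef i)"
proof
  assume "mJ j \<in> keys (tq coef i)"
  then obtain a where "a \<in> monos i" "mJ j = single None 1 + a" using keys_tq by blast
  then show False using lookup_None_t_mult lookup_mJ(1) by (metis zero_neq_one)
qed

lemma mweight_option:
  fixes a :: "'r option mono"
  shows "mweight (tw wt \<phi>) a = real (lookup a None) * wt + (\<Sum>r\<in>UNIV. real (lookup a (Some r)) * \<phi> r)"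
proof -
  have "mweight (tw wt \<phi>) a = (\<Sum>v\<in>insert None (range Some). real (lookup a v) * tw wt \<phi> v)"
    by (simp add: mweight_UNIV UNIV_option_conv)
  then show ?thesis by (simp add: sum.reindex tw_def)
qed

text \<open>The terms of t g_j and m_j have the same Cox degree, so \<open>\<phi>\<close> enters
  their weight difference only through \<open>wx\<close>.\<close>

lemma mweight_generator:
  assumes a: "exponent j a u" and \<phi>: "phi_of rhat \<phi> wx"
  shows "mweight (tw wt \<phi>) (single None 1 + a) = wt + inner u wx + mweight (tw wt \<phi>) (mJ j)"
proof -
  have "lookup a None = 0" "\<And>r. real (lookup a (Some r)) = Jind J j r + inner u (rhat r)"
    using a by (auto simp: exponent_def not_in_keys_iff_lookup_eq_zero)
  then have "mweight (tw wt \<phi>) (single None 1 + a) = wt + (\<Sum>r\<in>UNIV. (Jind J j r + inner u (rhat r)) * \<phi> r)"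
    by (simp add: mweight_option lookup_add lookup_single)
  also have "\<dots> = wt + (\<Sum>r\<in>UNIV. Jind J j r * \<phi> r) + (\<Sum>r\<in>UNIV. inner u (rhat r) * \<phi> r)"
    by (simp add: distrib_right sum.distrib)
  also have "(\<Sum>r\<in>UNIV. inner u (rhat r) * \<phi> r) = inner u wx"
    using \<phi> by (simp add: phi_of_def inner_sum_right[symmetric] mult.commute flip: inner_scaleR_right)
  also have "(\<Sum>r\<in>UNIV. Jind J j r * \<phi> r) = mweight (tw wt \<phi>) (mJ j)"
    by (simp add: mweight_option Jind_def) (intro sum.cong, auto)
  finally show ?thesis by simp
qed

text \<open>The rays positively span the space because \<open>Delta\<close> is bounded. Changing \<open>\<phi>\<close> by a relation
  of the rays does not affect the Cox-homogeneous generators, and a sign-definite \<open>\<phi>\<close> makes the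
  weight order have only finitely many monomials above a given one.\<close>

lemma positive_phi:
  obtains \<phi> where "phi_of rhat \<phi> w" "\<And>r. \<phi> r > 0"
proof -
  define K where "K = {\<Sum>r\<in>UNIV. \<phi> r *\<^sub>R rhat r | \<phi>. \<forall>r. \<phi> r > (0::real)}"
  have "w \<in> K"
  proof (rule ccontr)
    assume "w \<notin> K"
    have "convex K"
    proof (rule convexI)
      fix x y and s t :: real
      assume "x \<in> K" "y \<in> K" and st: "0 \<le> s" "0 \<le> t" "s + t = 1"
      then obtain \<phi> \<psi> where \<phi>: "\<forall>r. \<phi> r > 0" "x = (\<Sum>r\<in>UNIV. \<phi> r *\<^sub>R rhat r)"
        and \<psi>: "\<forall>r. \<psi> r > 0" "y = (\<Sum>r\<in>UNIV. \<psi> r *\<^sub>R rhat r)" unfolding K_def by blast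
      have "s *\<^sub>R x + t *\<^sub>R y = (\<Sum>r\<in>UNIV. (s * \<phi> r + t * \<psi> r) *\<^sub>R rhat r)"
        unfolding \<phi>(2) \<psi>(2) by (simp add: scaleR_sum_right scaleR_add_left sum.distrib)
      moreover have "s * \<phi> r + t * \<psi> r > 0" for r
      proof (cases "s = 0")
        case False
        then have "s * \<phi> r > 0" "t * \<psi> r \<ge> 0" using st \<phi>(1) \<psi>(1) by (simp_all add: less_imp_le)
        then show ?thesis by linarith
      qed (use st \<psi>(1) in simp)
      ultimately show "s *\<^sub>R x + t *\<^sub>R y \<in> K"
        unfolding K_def by (intro CollectI exI[of _ "\<lambda>r. s * \<phi> r + t * \<psi> r"] conjI allI)
    qed
    moreover have "(\<Sum>r\<in>UNIV. 1 *\<^sub>R rhat r) \<in> K"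
      unfolding K_def by (intro CollectI exI[of _ "\<lambda>_. 1"]) simp
    then have "K \<noteq> {}" by blast
    ultimately obtain a b where a: "a \<noteq> 0" "\<forall>x\<in>{w}. inner a x \<le> b" "\<forall>x\<in>K. inner a x \<ge> b"
      using separating_hyperplane_sets[of "{w}" K] \<open>w \<notin> K\<close> by auto
    have "inner a (rhat r) \<ge> 0" for r
    proof (rule ccontr)
      assume neg: "\<not> inner a (rhat r) \<ge> 0"
      define C where "C = (\<Sum>s\<in>UNIV - {r}. inner a (rhat s))"
      define T where "T = max 1 ((\<bar>b\<bar> + \<bar>C\<bar> + 1) / (- inner a (rhat r)))"
      have "T > 0" by (simp add: T_def)
      have "(\<Sum>s\<in>UNIV. (if s = r then T else 1) *\<^sub>R rhat s) \<in> K"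
        unfolding K_def using \<open>T > 0\<close> by (intro CollectI exI[of _ "\<lambda>s. if s = r then T else 1"]) simp
      then have "b \<le> inner a (\<Sum>s\<in>UNIV. (if s = r then T else 1) *\<^sub>R rhat s)" using a(3) by blast
      also have "\<dots> = T * inner a (rhat r) + C"
        unfolding inner_sum_right C_def by (subst sum.remove[of UNIV r]) auto
      finally have "b \<le> T * inner a (rhat r) + C" .
      moreover have "(\<bar>b\<bar> + \<bar>C\<bar> + 1) / (- inner a (rhat r)) \<le> T" by (simp add: T_def)
      then have "\<bar>b\<bar> + \<bar>C\<bar> + 1 \<le> T * (- inner a (rhat r))"
        using neg by (subst (asm) pos_divide_le_eq) auto
      ultimately show False by simp
    qed
    then show False using eq_0_if_nonneg a(1) by blast
  qed
  then show thesis using that unfolding K_def phi_of_def by blast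
qed

subsection \<open>The Groebner cone\<close>

text \<open>If some \<open>u\<close> violated its inequality, the leading monomial of the generator
  would be t times a monomial of g_j. It would have to lie in I_0, but no m_k divides such a
  product.\<close>

lemma nabla_subset_Nab:
  assumes gt: "admissible_order gt"
    and coef: "\<And>j a. j < c \<Longrightarrow> a \<in> monos j \<Longrightarrow> coef (j, a) \<noteq> 0"
  shows "nabla gt rhat (I0_ext c J) (I_fam rhat c J coef) \<subseteq> Nab"
proof -
  let ?I = "I_fam rhat c J coef"
  define C where "C = (\<Inter>j\<in>{..<c}. \<Inter>u\<in>Xi j. {p :: real \<times> (real^'n). fst p + inner u (snd p) \<ge> 0})"
  have "closed C"
    unfolding C_def by (intro closed_INT ballI closed_Collect_le continuous_intros)
  have "(- wt, - wx) \<in> C"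
    if \<phi>: "phi_of rhat \<phi> wx" and lead: "lead_ideal (weight_order (tw wt \<phi>) gt) ?I = I0_ext c J" for wt wx \<phi>
  proof -
    let ?gt = "weight_order (tw wt \<phi>) gt"
    have mo: "monomial_order ?gt" using gt by (intro monomial_order_weight) (simp add: admissible_order_def)
    have "wt + inner u wx \<le> 0" if j: "j < c" and u: "u \<in> Xi j" for j u
    proof (rule ccontr)
      assume "\<not> wt + inner u wx \<le> 0"
      obtain a where a: "a \<in> monos j" "exponent j a u" using Xi_exponent[OF u] by blast
      let ?f = "monomial (mJ j) + tq coef j"
      have heavy: "mweight (tw wt \<phi>) (single None 1 + a) > mweight (tw wt \<phi>) (mJ j)"
        using mweight_generator[OF a(2) \<phi>, of wt] \<open>\<not> _ \<le> 0\<close> by simp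
      have "lookup (monomial (mJ j)) (single None 1 + a) = 0"
        using heavy by (auto simp: monomial_def lookup_single when_def)
      then have mem: "single None 1 + a \<in> keys ?f"
        using lookup_tq[OF a(1), of coef] coef[OF j a(1)] by (simp add: in_keys_iff lookup_add)
      then have "?f \<noteq> 0" by force
      define b where "b = lead_mono ?gt ?f"
      have b: "b \<in> keys ?f" using lead_mono(1)[OF mo \<open>?f \<noteq> 0\<close>] by (simp add: b_def)
      have "\<not> ?gt b (single None 1 + a)" if "b = mJ j"
        using heavy that by (simp add: weight_order_def)
      then have "b \<noteq> mJ j" using lead_mono(2)[OF mo \<open>?f \<noteq> 0\<close> mem] heavy unfolding b_def[symmetric] by fastforce
      then have "b \<in> keys (tq coef j)"
        using b keys_add[of "monomial (mJ j)" "tq coef j"] by (auto simp: monomial_def)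
      then obtain a' where a': "a' \<in> monos j" "b = single None 1 + a'" using keys_tq by blast
      have "?f \<in> ?I" unfolding I_fam_eq using j by (auto intro: ideal_gen_base)
      then have "monomial b \<in> lead_ideal ?gt ?I"
        unfolding lead_ideal_def b_def using \<open>?f \<noteq> 0\<close> by (intro ideal_gen_base) blast
      then have "monomial b \<in> ideal_gen (monomial ` (mJ ` {..<c}))"
        unfolding lead I0_ext_eq by (rule rev_subsetD) (rule ideal_gen_mono, blast)
      moreover have "b \<in> keys (monomial b)" by (simp add: monomial_def)
      ultimately obtain k d where k: "k < c" "b = d + mJ k" using monomial_ideal_keys by blast
      have "lookup a' (Some r) \<ge> 1" if "r \<in> J k" for r
      proof -
        have "lookup b (Some r) = lookup a' (Some r)" by (simp add: a'(2) lookup_add lookup_single)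
        then show ?thesis using that by (simp add: k(2) lookup_add)
      qed
      then show False using a'(1) k(1) unfolding g_monos_def in_I0_def by blast
    qed
    then show ?thesis unfolding C_def by fastforce
  qed
  then have "cone_C gt rhat (I0_ext c J) ?I \<subseteq> C"
    unfolding cone_C_def by (intro closure_minimal \<open>closed C\<close>) blast
  then show ?thesis
    unfolding nabla_def Nab_iff subset_iff by (fastforce simp: C_def)
qed

text \<open>Where all inequalities are strict, m_j leads its generator and the product criterion
  applies; the remaining points enter through the closure.\<close>

lemma Nab_subset_nabla:
  assumes gt: "admissible_order gt"
  shows "Nab \<subseteq> nabla gt rhat (I0_ext c J) (I_fam rhat c J coef)"
proof
  let ?I = "I_fam rhat c J coef"
  let ?S = "{(- wt, - wx) | wt wx. \<exists>\<phi>. phi_of rhat \<phi> wx \<and>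
     lead_ideal (weight_order (tw wt \<phi>) gt) ?I = I0_ext c J}"
  have strict: "(1, w) \<in> ?S" if w: "\<And>j u. j < c \<Longrightarrow> u \<in> Xi j \<Longrightarrow> inner u w > -1" for w
  proof -
    obtain \<psi> where \<psi>: "phi_of rhat \<psi> w" "\<And>r. \<psi> r > 0" using positive_phi by blast
    \<comment> \<open>The cone records negatives of weights, so the weight for \<open>(1, w)\<close>
      is \<open>(-1, - w)\<close>, and a negative \<open>\<phi>\<close> gives every variable
      negative weight.\<close>
    define \<phi> where "\<phi> r = - \<psi> r" for r
    have \<phi>: "phi_of rhat \<phi> (- w)" using \<psi>(1) by (simp add: phi_of_def \<phi>_def sum_negf)
    let ?gt = "weight_order (tw (-1) \<phi>) gt"
    have mo: "monomial_order ?gt" using gt by (intro monomial_order_weight) (simp add: admissible_order_def)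
    have neg: "tw (-1) \<phi> v < 0" for v using \<psi>(2) by (cases v) (simp_all add: tw_def \<phi>_def)
    have fin: "finite {b. ?gt b a}" for a
      by (rule finite_subset[OF _ finite_mweight_ge[of "tw (-1) \<phi>" "mweight (tw (-1) \<phi>) a", OF neg]])
        (auto simp: weight_order_def)
    have lower: "?gt (mJ j) b" if "j < c" "b \<in> keys (tq coef j)" for j b
    proof -
      obtain a where a: "a \<in> monos j" "b = single None 1 + a" using keys_tq[OF \<open>b \<in> _\<close>] by blast
      obtain u where u: "u \<in> Xi j" "exponent j a u" using g_monos_exponent[OF a(1)] by blast
      show ?thesis
        using mweight_generator[OF u(2) \<phi>, of "-1"] w[OF that(1) u(1)]
        unfolding weight_order_def a(2) by simp
    qed
    have "lead_ideal ?gt ?I = I0_ext c J"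
      unfolding I_fam_eq I0_ext_eq by (rule lead_ideal_coprime[OF mo fin lower mJ_coprime])
    then show ?thesis using \<phi> by force
  qed
  fix w assume w: "w \<in> Nab"
  \<comment> \<open>Shrinking towards the origin makes every inequality strict, since the origin
    satisfies all of them strictly.\<close>
  define X where "X n = (1::real, (1 - inverse (real (Suc n))) *\<^sub>R w)" for n
  have "X n \<in> ?S" for n
    unfolding X_def
  proof (rule strict)
    fix j u assume "j < c" "u \<in> Xi j"
    then have "inner u w \<ge> -1" using w unfolding Nab_iff by blast
    moreover define t where "t = inverse (real (Suc n))"
    have "0 < t" "t \<le> 1" by (auto simp: t_def field_simps)
    moreover have "(1 - t) * inner u w \<ge> (1 - t) * (-1)" using calculation by (intro mult_left_mono) auto
    ultimately show "-1 < inner u ((1 - inverse (real (Suc n))) *\<^sub>R w)"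
      unfolding t_def[symmetric] by simp
  qed
  moreover have "X \<longlonglongrightarrow> (1, (1 - 0) *\<^sub>R w)"
    unfolding X_def by (intro tendsto_intros LIMSEQ_inverse_real_of_nat)
  ultimately have "(1, w) \<in> closure ?S" unfolding closure_sequential by auto
  then show "w \<in> nabla gt rhat (I0_ext c J) ?I" unfolding nabla_def cone_C_def by blast
qed

subsection \<open>The Bergman fan\<close>

text \<open>If no point of \<open>Xi j\<close> is tight, m_j is the unique lightest term of its
  generator, whose initial form is then a monomial.\<close>

lemma bergman_fan_imp_tight:
  assumes w: "w \<in> Nab" and bf: "(1, w) \<in> bergman_fan rhat (I_fam rhat c J coef)"
  shows "w \<in> tight"
proof (rule ccontr)
  assume "w \<notin> tight"
  then obtain j where j: "j < c" "\<And>u. u \<in> Xi j \<Longrightarrow> inner u w \<noteq> -1" using w unfolding tight_def by blast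
  obtain \<phi> where \<phi>: "phi_of rhat \<phi> w" "\<And>a. monomial a \<notin> init_ideal (tw 1 \<phi>) (I_fam rhat c J coef)"
    using bf unfolding bergman_fan_def by blast
  let ?f = "monomial (mJ j) + tq coef j" and ?w = "mweight (tw 1 \<phi>)"
  have heavy: "?w b > ?w (mJ j)" if b: "b \<in> keys (tq coef j)" for b
  proof -
    obtain a where a: "a \<in> monos j" "b = single None 1 + a" using keys_tq[OF b] by blast
    obtain u where u: "u \<in> Xi j" "exponent j a u" using g_monos_exponent[OF a(1)] by blast
    have "inner u w > -1" using w j u(1) unfolding Nab_iff by (metis order_le_less)
    then show ?thesis using mweight_generator[OF u(2) \<phi>(1), of 1] unfolding a(2) by simp
  qed
  have one: "lookup ?f (mJ j) = 1"
    using mJ_notin_keys_tq[of j coef j]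
    by (simp add: lookup_add monomial_def not_in_keys_iff_lookup_eq_zero)
  then have mem: "mJ j \<in> keys ?f" by (simp add: in_keys_iff)
  have cases: "b = mJ j \<or> b \<in> keys (tq coef j)" if "b \<in> keys ?f" for b
    using that keys_add[of "monomial (mJ j)" "tq coef j"] by (auto simp: monomial_def)
  have Min: "Min (?w ` keys ?f) = ?w (mJ j)"
    using mem cases heavy by (intro Min_eqI) (auto intro: less_imp_le)
  have "{b \<in> keys ?f. ?w b = ?w (mJ j)} = {mJ j}"
    using mem cases heavy by fastforce
  then have "init_form (tw 1 \<phi>) ?f = monomial (mJ j)"
    unfolding init_form_def Min by (simp add: one) (simp add: monomial_def)
  moreover have "?f \<in> I_fam rhat c J coef" unfolding I_fam_eq using j(1) by (auto intro: ideal_gen_base)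
  ultimately have "monomial (mJ j) \<in> init_ideal (tw 1 \<phi>) (I_fam rhat c J coef)"
    unfolding init_ideal_def by (intro ideal_gen_base) force
  then show False using \<phi>(2) by blast
qed

text \<open>Each part \<open>J j\<close> contains a ray \<open>\<rho> j\<close> whose variable is absent from every monomial of weight
  equal to that of its generator, except that it divides \<open>mJ j\<close> exactly once. So the initial forms
  can be solved for these variables, giving a common zero in the torus.\<close>

lemma tight_imp_bergman_fan:
  fixes gt :: "'r option mono \<Rightarrow> 'r option mono \<Rightarrow> bool"
  assumes w: "w \<in> tight" and gt: "admissible_order gt"
    and coef: "\<And>j A. j < c \<Longrightarrow> A \<subseteq> monos j \<Longrightarrow> A \<noteq> {} \<Longrightarrow> (\<Sum>a\<in>A. coef (j, a)) \<noteq> 0"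
  shows "(1, w) \<in> bergman_fan rhat (I_fam rhat c J coef)"
proof -
  obtain \<phi> where \<phi>: "phi_of rhat \<phi> w" "\<And>r. \<phi> r > 0" using positive_phi by blast
  let ?\<omega> = "tw 1 \<phi>"
  have "\<exists>r\<in>J j. \<forall>u\<in>min_face w. inner u (rhat r) = -1" if "j < c" for j
    using min_face_strata[OF w] that unfolding strata_def by blast
  then obtain \<rho> where \<rho>: "\<And>j. j < c \<Longrightarrow> \<rho> j \<in> J j"
    "\<And>j u. j < c \<Longrightarrow> u \<in> min_face w \<Longrightarrow> inner u (rhat (\<rho> j)) = -1" by metis
  have \<rho>_part: "i = j" if "i < c" "j < c" "\<rho> i \<in> J j" for i j
    using part_unique[OF that(1,2) \<rho>(1) that(3)] that(1) by blast
  define A where "A j = {a \<in> monos j. mweight ?\<omega> (single None 1 + a) = mweight ?\<omega> (mJ j)}" for j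
  define s where "s j = (\<Sum>a\<in>A j. coef (j, a))" for j
  \<comment> \<open>The variables of the rays \<open>\<rho> j\<close> get \<open>- s j\<close> and
    all others 1; the \<open>\<rho> j\<close> are distinct since the parts are disjoint. Then m_j
    evaluates to \<open>- s j\<close> and the tight part of its tail to \<open>s j\<close>.\<close>
  define z where "z v = (case v of None \<Rightarrow> 1 | Some r \<Rightarrow> \<Prod>j<c. if r = \<rho> j then - s j else 1)" for v
  have A_iff: "inner u w = -1" if "a \<in> A j" "exponent j a u" for a j u
    using mweight_generator[OF that(2) \<phi>(1), of 1] that(1) by (simp add: A_def)
  have s: "s j \<noteq> 0" if j: "j < c" for j
  proof -
    obtain u where u: "u \<in> Xi j" "inner u w = -1" using w j unfolding tight_def by blast
    obtain a where a: "a \<in> monos j" "exponent j a u" using Xi_exponent[OF u(1)] by blast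
    have "a \<in> A j" using a(1) mweight_generator[OF a(2) \<phi>(1), of 1] u(2) by (simp add: A_def)
    then show ?thesis unfolding s_def using coef[OF j] A_def by (metis (no_types, lifting) empty_iff mem_Collect_eq subsetI)
  qed
  have z_ne: "z v \<noteq> 0" for v
    using s by (cases v) (simp_all add: z_def)
  have z_\<rho>: "z (Some (\<rho> j)) = - s j" if j: "j < c" for j
  proof -
    have "(\<Prod>i<c. if \<rho> j = \<rho> i then - s i else 1) = (\<Prod>i<c. if i = j then - s i else 1)"
      using \<rho>_part \<rho>(1) j by (intro prod.cong) (auto, metis)
    then show ?thesis using j by (simp add: z_def)
  qed
  have z_other: "z (Some r) = 1" if "\<And>j. j < c \<Longrightarrow> r \<noteq> \<rho> j" for r
    using that by (simp add: z_def)
  have eval_mJ: "mono_eval z (mJ j) = - s j" if j: "j < c" for j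
  proof -
    have "mono_eval z (mJ j) = (\<Prod>v\<in>UNIV. if v = Some (\<rho> j) then z v else 1)"
      unfolding mono_eval_superset[OF finite subset_UNIV]
    proof (rule prod.cong)
      fix v :: "'r option"
      show "z v ^ lookup (mJ j) v = (if v = Some (\<rho> j) then z v else 1)"
      proof (cases v)
        case (Some r)
        show ?thesis
        proof (cases "r \<in> J j \<and> r \<noteq> \<rho> j")
          case True
          then have "r \<noteq> \<rho> i" if "i < c" for i using \<rho>_part[OF that j] by blast
          then show ?thesis using True Some z_other by simp
        next
          case False
          show ?thesis
          proof (cases "r = \<rho> j")
            case True
            then show ?thesis using Some \<rho>(1)[OF j] by simp
          next
            case neq: False
            then show ?thesis using Some False by simp
          qed
        qed
      qed simp
    qed simp
    then show ?thesis using z_\<rho>[OF j] by simp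
  qed
  have eval_A: "mono_eval z (single None 1 + a) = 1" if a: "a \<in> A j" and j: "j < c" for a j
    unfolding mono_eval_superset[OF finite subset_UNIV]
  proof (intro prod.neutral ballI)
    fix v :: "'r option"
    have aM: "a \<in> monos j" using a by (simp add: A_def)
    then obtain u where u: "u \<in> Xi j" "exponent j a u" using g_monos_exponent by blast
    have uG: "u \<in> G w j" using A_iff[OF a u(2)] u(1) by (simp add: G_def Xi_def)
    show "z v ^ lookup (single None 1 + a) v = 1"
    proof (cases v)
      case None
      then show ?thesis by (simp add: z_def)
    next
      case (Some r)
      show ?thesis
      proof (cases "\<exists>i<c. r = \<rho> i")
        case True
        then obtain i where i: "i < c" "r = \<rho> i" by blast
        have "inner u (rhat r) = - Jind J j r"
          unfolding i(2) by (rule G_inner_ray[OF w \<rho>(2)[OF i(1)] j uG])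
        then have "real (lookup a (Some r)) = 0" using u(2) unfolding exponent_def by simp
        then show ?thesis using Some by (simp add: lookup_add lookup_single)
      next
        case False
        then have "z v = 1" using z_other Some by blast
        then show ?thesis by simp
      qed
    qed
  qed
  \<comment> \<open>A tie-break under which m_j, free of t, precedes its tail, where t has exponent
    1. Locality of \<open>gt\<close> in t alone does not compare m_j with t times another
    monomial.\<close>
  have mo: "monomial_order (weight_order (tw (-1) (\<lambda>_. 0)) gt)"
    using gt by (intro monomial_order_weight) (simp add: admissible_order_def)
  have "monomial b \<notin> init_ideal ?\<omega> (I_fam rhat c J coef)" for b
    unfolding I_fam_eq
  proof (rule init_ideal_no_monomial[OF mo _ _ mJ_coprime z_ne])
    show "?\<omega> v > 0" for v using \<phi>(2) by (cases v) (simp_all add: tw_def)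
  next
    fix j b assume j: "j < c" and b: "b \<in> keys (tq coef j)"
    obtain a where a: "a \<in> monos j" "b = single None 1 + a" using keys_tq[OF b] by blast
    obtain u where u: "u \<in> Xi j" "exponent j a u" using g_monos_exponent[OF a(1)] by blast
    have "inner u w \<ge> -1" using w j u(1) unfolding tight_def Nab_iff by blast
    moreover have "phi_of rhat (\<lambda>_. 0) 0" by (simp add: phi_of_def)
    note mweight_generator[OF u(2) this, of "-1"] mweight_generator[OF u(2) \<phi>(1), of 1]
    ultimately show "mweight ?\<omega> (mJ j) < mweight ?\<omega> b \<or> mweight ?\<omega> (mJ j) = mweight ?\<omega> b \<and>
        weight_order (tw (-1) (\<lambda>_. 0)) gt (mJ j) b"
      unfolding a(2) weight_order_def by auto
  next
    fix j assume j: "j < c"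
    let ?e = "\<lambda>b. if mweight ?\<omega> b = mweight ?\<omega> (mJ j) then mono_eval z b else 0"
    have "term_sum ?e (tq coef j) = (\<Sum>a\<in>monos j. if a \<in> A j then coef (j, a) else 0)"
      unfolding tq_def term_sum_sum using eval_A[OF _ j]
      by (intro sum.cong) (auto simp: A_def)
    also have "\<dots> = s j"
      unfolding s_def
      by (subst sum.inter_restrict[OF finite_g_monos, symmetric], rule sum.cong) (auto simp: A_def)
    finally show "term_sum ?e (monomial (mJ j) + tq coef j) = 0"
      using eval_mJ[OF j] by (simp add: term_sum_add monomial_def)
  qed auto
  then show ?thesis unfolding bergman_fan_def using \<phi>(1) by blast
qed

end

theorem mainTheorem5:
  fixes Delta :: "(real^'n) set"
    and rhat :: "'r::finite \<Rightarrow> real^'n"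
    and c :: nat
    and J :: "nat \<Rightarrow> 'r set"
    and gt :: "'r option mono \<Rightarrow> 'r option mono \<Rightarrow> bool"
  assumes "reflexive Delta"
    and "bij_betw rhat UNIV (ray_generators Delta)"
    and "nef_partition Delta rhat c J"
    and "admissible_order gt"
  shows "\<exists>P :: (nat \<times> 'r option mono) mpoly. P \<noteq> 0 \<and>
    (\<forall>coef. poly_eval P coef \<noteq> 0 \<longrightarrow>
      (let I = I_fam rhat c J coef;
           Nab = nabla gt rhat (I0_ext c J) I;
           T = trop_special Nab (bergman_fan rhat I);
           S = strata Delta rhat c J;
           \<Phi> = (\<lambda>F. minkowski_sum (\<lambda>i. dual_face Nab F \<inter> Delta_part rhat J i) c)
       in (\<forall>F\<in>T. \<Phi> F \<in> S) \<and> bij_betw \<Phi> T S \<and>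
          (\<forall>F\<in>T. \<forall>F'\<in>T. F \<subseteq> F' \<longleftrightarrow> \<Phi> F' \<subseteq> \<Phi> F)))"
proof -
  have range: "range rhat = ray_generators Delta" using assms(2) by (simp add: bij_betw_def)
  interpret nef_setting Delta rhat c J
  proof
    show "Delta = halfspaces (range rhat)" using reflexive_eq_halfspaces[OF assms(1)] range by simp
    show "bounded Delta" using reflexive_compact[OF assms(1)] by (rule compact_imp_bounded)
    show "integral_vec (rhat r)" for r
      using range by (auto simp: ray_generators_def primitive_vec_def)
  qed (rule assms(3))
  \<comment> \<open>The type of rays is nonempty, and an empty sum of indicators could not equal
    1.\<close>
  have "0 < c" using sum_Jind by (cases c) auto
  \<comment> \<open>One factor for each set that may occur as \<open>A j\<close> in
    \<open>tight_imp_bergman_fan\<close>; the singletons make all coefficients nonzero.\<close>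
  define P :: "(nat \<times> 'r option mono) mpoly" where
    "P = (\<Prod>j<c. \<Prod>A\<in>Pow (monos j) - {{}}. \<Sum>a\<in>A. var (j, a))"
  have P_eval: "poly_eval P coef = (\<Prod>j<c. \<Prod>A\<in>Pow (monos j) - {{}}. \<Sum>a\<in>A. coef (j, a))" for coef
    by (simp add: P_def poly_eval_prod poly_eval_sum)
  \<comment> \<open>With all coefficients 1, every factor is the size of a nonempty finite
    set.\<close>
  have "poly_eval P (\<lambda>_. 1) \<noteq> 0"
    unfolding P_eval using finite_g_monos by (auto dest: finite_subset)
  then have "P \<noteq> 0" by auto
  have *: "(\<forall>F\<in>T. \<Phi> F \<in> S) \<and> bij_betw \<Phi> T S \<and> (\<forall>F\<in>T. \<forall>F'\<in>T. F \<subseteq> F' \<longleftrightarrow> \<Phi> F' \<subseteq> \<Phi> F)"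
    if coef: "poly_eval P coef \<noteq> 0" and I: "I = I_fam rhat c J coef"
      and N: "N = nabla gt rhat (I0_ext c J) I"
      and T: "T = trop_special N (bergman_fan rhat I)"
      and S: "S = strata Delta rhat c J"
      and \<Phi>: "\<Phi> = (\<lambda>F. minkowski_sum (\<lambda>i. dual_face N F \<inter> Delta_part rhat J i) c)"
    for coef I N T S \<Phi>
  proof -
    have gen: "(\<Sum>a\<in>A. coef (j, a)) \<noteq> 0" if "j < c" "A \<subseteq> monos j" "A \<noteq> {}" for j A
      using coef that finite_g_monos unfolding P_eval by auto
    have "coef (j, a) \<noteq> 0" if "j < c" "a \<in> monos j" for j a
      using gen[of j "{a}"] that by simp
    then have NN: "N = Nab"
      unfolding N I using nabla_subset_Nab[OF assms(4)] Nab_subset_nabla[OF assms(4)] by blast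
    have T_iff: "F \<in> T \<longleftrightarrow> F face_of Nab \<and> F \<subseteq> tight \<and> F \<noteq> {}" for F
    proof
      assume F: "F \<in> T"
      then have "F face_of Nab" "F \<noteq> {}" "\<forall>w\<in>F. (1, w) \<in> bergman_fan rhat I"
        unfolding T NN trop_special_def by auto
      moreover have "F \<subseteq> Nab" using \<open>F face_of Nab\<close> by (rule face_of_imp_subset)
      ultimately show "F face_of Nab \<and> F \<subseteq> tight \<and> F \<noteq> {}"
        using bergman_fan_imp_tight unfolding I by blast
    next
      assume "F face_of Nab \<and> F \<subseteq> tight \<and> F \<noteq> {}"
      then show "F \<in> T"
        unfolding T NN trop_special_def I
        using tight_subset_frontier[OF _ \<open>0 < c\<close>] tight_imp_bergman_fan[OF _ assms(4) gen] by blast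
    qed
    have \<Phi>_eq: "\<Phi> = Phi" unfolding \<Phi> NN by (rule ext) (simp add: Phi_def)
    have order: "F \<subseteq> F' \<longleftrightarrow> Phi F' \<subseteq> Phi F" if "F \<in> T" "F' \<in> T" for F F'
      using Phi_antimono[of F F'] Phi_order_reflecting[of F F'] that unfolding T_iff by blast
    have into: "Phi F \<in> S" if "F \<in> T" for F
      using Phi_in_strata that unfolding T_iff S by blast
    have "inj_on Phi T"
    proof (rule inj_onI)
      fix F F' assume "F \<in> T" "F' \<in> T" "Phi F = Phi F'"
      then show "F = F'" using order[of F F'] order[of F' F] by simp
    qed
    moreover have "S \<subseteq> Phi ` T"
      using Phi_surjective T_iff unfolding S by (metis image_eqI subsetI)
    ultimately have "bij_betw Phi T S" using into unfolding bij_betw_def by blast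
    then show ?thesis unfolding \<Phi>_eq using into order by blast
  qed
  show ?thesis
    unfolding Let_def
    by (rule exI[of _ P], intro conjI \<open>P \<noteq> 0\<close> allI impI)
      (use *[OF _ refl refl refl refl refl] in blast)+
qed

end
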